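(* Let $\mathfrak{g}$ be a $4$-dimensional unimodular real Lie algebra. (a) When $b^+(\mathfrak{g})=3$, every almost complex structure $J$ on $\mathfrak{g}$ is tamed and complex (integrable), and has $h_J^-=2$. (b) When $b^+(\mathfrak{g})=2$, every almost complex structure $J$ on $\mathfrak{g}$ is either tamed or complex (integrable), corresponding to $h_J^-=1$ or $\Lambda_J^-(\mathfrak{g}^* )\subset\mathcal{Z}$ respectively. (c) When $b^+(\mathfrak{g})=1$, every almost complex structure $J$ on $\mathfrak{g}$ is either tamed or satisfies $\Lambda_J^-(\mathfrak{g}^* )\cap\mathcal{Z}\neq\{0\}$.
   Context: $\mathfrak{g}$ is unimodular if $\mathrm{tr}(\mathrm{ad}_\xi)=0$ for all $\xi\in\mathfrak{g}$. $H^*(\mathfrak{g})$ is the Chevalley–Eilenberg cohomology of $(\Lambda^*(\mathfrak{g}^* ),d)$, $d\phi(u,v)=-\phi([u,v])$ on $1$-forms; $\mathcal{Z}\subset\Lambda^2(\mathfrak{g}^* )$ is the space of closed $2$-forms. An almost complex structure is a linear automorphism $J$ of the vector space $\mathfrak{g}$ with $J^2=-\mathrm{id}$; $\mathfrak{g}$ carries the orientation induced by $J$. It is complex (integrable) if $[u,v]-J[Ju,v]-J[u,Jv]-[Ju,Jv]$ with the sign convention of the Nijenhuis tensor vanishes, i.e. $[u,v]+J[Ju,v]+J[u,Jv]-[Ju,Jv]=0$ for all $u,v\in\mathfrak{g}$ (equivalently the $-\mathbf{i}$ eigenspace of $J$ in $\mathfrak{g}\otimes\mathbb{C}$ is a subalgebra).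 Fix a nonzero $\zeta\in\Lambda^4(\mathfrak{g})$ inducing the orientation; since $\mathfrak{g}$ is unimodular, $(\alpha,\beta)\mapsto(\alpha\wedge\beta)(\zeta)$ induces a symmetric non-degenerate pairing on $H^2(\mathfrak{g})$, of signature $(b^+(\mathfrak{g}),b^+(\mathfrak{g}))$, where $b^+(\mathfrak{g})$ is the maximal dimension of a positive definite subspace. $\Lambda_J^{\pm}(\mathfrak{g}^* )$ are the $\pm1$-eigenspaces of $\alpha(\cdot,\cdot)\mapsto\alpha(J\cdot,J\cdot)$ on $\Lambda^2(\mathfrak{g}^* )$; $H_J^{-}(\mathfrak{g})\subset H^2(\mathfrak{g})$ is the subspace of classes representable by a closed form in $\Lambda_J^-(\mathfrak{g}^* )$, and $h_J^-=\dim H_J^-(\mathfrak{g})$. $J$ is tamed if there exists a closed $2$-form $\varphi$ on $\mathfrak{g}$ with $\varphi(v,Jv)>0$ for all nonzero $v\in\mathfrak{g}$. *)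

theory Defs
  imports "HOL-Analysis.Analysis" "HOL-Library.Function_Algebras"
begin

text \<open>Pointwise scalar multiplication makes functions, hence forms on a real vector space,
  a real vector space.\<close>

instantiation "fun" :: (type, real_vector) real_vector
begin

definition scaleR_fun :: "real \<Rightarrow> ('a \<Rightarrow> 'b) \<Rightarrow> 'a \<Rightarrow> 'b" where
  "scaleR_fun r f = (\<lambda>x. r *\<^sub>R f x)"

instance
  by standard (auto simp: scaleR_fun_def fun_eq_iff scaleR_add_right scaleR_add_left)

end

section \<open>Quotient vector spaces\<close>

text \<open>For a linear subspace \<open>B\<close>, the elements of a quotient by \<open>B\<close> are the cosets of \<open>B\<close>, and
  the vector space operations on cosets are carried out on representatives.\<close>

definition coset :: "'v::real_vector set \<Rightarrow> 'v \<Rightarrow> 'v set" where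
  "coset B x = {x + b | b. b \<in> B}"

definition quot_subspace :: "'v::real_vector set \<Rightarrow> 'v set set \<Rightarrow> bool" where
  "quot_subspace B W \<longleftrightarrow>
     W \<subseteq> range (coset B) \<and> coset B 0 \<in> W \<and>
     (\<forall>x y. coset B x \<in> W \<longrightarrow> coset B y \<in> W \<longrightarrow> coset B (x + y) \<in> W) \<and>
     (\<forall>r x. coset B x \<in> W \<longrightarrow> coset B (r *\<^sub>R x) \<in> W)"

text \<open>In the next definition \<open>f\<close> chooses a representative of each coset in the finite set \<open>S\<close>.\<close>

definition quot_independent :: "'v::real_vector set \<Rightarrow> 'v set set \<Rightarrow> bool" where
  "quot_independent B S \<longleftrightarrow>
     (\<forall>a f. (\<forall>C\<in>S. f C \<in> C) \<longrightarrow> coset B (\<Sum>C\<in>S. a C *\<^sub>R f C) = coset B 0 \<longrightarrow>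
        (\<forall>C\<in>S. a C = (0::real)))"

definition quot_dim :: "'v::real_vector set \<Rightarrow> 'v set set \<Rightarrow> nat" where
  "quot_dim B W = Max {card S | S. finite S \<and> S \<subseteq> W \<and> quot_independent B S}"

section \<open>Lie algebras and their Chevalley--Eilenberg cohomology\<close>

definition lie_algebra :: "('a::real_vector \<Rightarrow> 'a \<Rightarrow> 'a) \<Rightarrow> bool" where
  "lie_algebra br \<longleftrightarrow> bilinear br \<and> (\<forall>u. br u u = 0) \<and>
     (\<forall>u v w. br u (br v w) + br v (br w u) + br w (br u v) = 0)"

text \<open>\<open>extend_basis {}\<close> is some basis of the whole space; in finite dimension the trace does not
  depend on it.\<close>

definition lin_trace :: "('a::real_vector \<Rightarrow> 'a) \<Rightarrow> real" where
  "lin_trace f = (\<Sum>b\<in>extend_basis {}. representation (extend_basis {}) (f b) b)"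

definition unimodular :: "('a::real_vector \<Rightarrow> 'a \<Rightarrow> 'a) \<Rightarrow> bool" where
  "unimodular br \<longleftrightarrow> (\<forall>\<xi>. lin_trace (br \<xi>) = 0)"

definition two_forms :: "('a::real_vector \<Rightarrow> 'a \<Rightarrow> real) set" where
  "two_forms = {\<alpha>. bilinear \<alpha> \<and> (\<forall>u. \<alpha> u u = 0)}"

definition ce_d1 :: "('a \<Rightarrow> 'a \<Rightarrow> 'a) \<Rightarrow> ('a \<Rightarrow> real) \<Rightarrow> 'a \<Rightarrow> 'a \<Rightarrow> real" where
  "ce_d1 br \<phi> = (\<lambda>u v. - \<phi> (br u v))"

text \<open>On \<open>2\<close>-forms, \<open>d\<close> is determined by \<open>ce_d1\<close> and
  \<open>d (\<phi> \<and> \<psi>) = d \<phi> \<and> \<psi> - \<phi> \<and> d \<psi>\<close>, which gives the following formula.\<close>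

definition ce_d2 ::
  "('a \<Rightarrow> 'a \<Rightarrow> 'a) \<Rightarrow> ('a \<Rightarrow> 'a \<Rightarrow> real) \<Rightarrow> 'a \<Rightarrow> 'a \<Rightarrow> 'a \<Rightarrow> real" where
  "ce_d2 br \<alpha> = (\<lambda>u v w. - \<alpha> (br u v) w + \<alpha> (br u w) v - \<alpha> (br v w) u)"

definition closed_two_forms ::
  "('a::real_vector \<Rightarrow> 'a \<Rightarrow> 'a) \<Rightarrow> ('a \<Rightarrow> 'a \<Rightarrow> real) set" where
  "closed_two_forms br = {\<alpha> \<in> two_forms. \<forall>u v w. ce_d2 br \<alpha> u v w = 0}"

definition exact_two_forms ::
  "('a::real_vector \<Rightarrow> 'a \<Rightarrow> 'a) \<Rightarrow> ('a \<Rightarrow> 'a \<Rightarrow> real) set" where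
  "exact_two_forms br = ce_d1 br ` {\<phi>. linear \<phi>}"

definition coh_class ::
  "('a::real_vector \<Rightarrow> 'a \<Rightarrow> 'a) \<Rightarrow> ('a \<Rightarrow> 'a \<Rightarrow> real) \<Rightarrow> ('a \<Rightarrow> 'a \<Rightarrow> real) set" where
  "coh_class br \<alpha> = coset (exact_two_forms br) \<alpha>"

definition H2 :: "('a::real_vector \<Rightarrow> 'a \<Rightarrow> 'a) \<Rightarrow> ('a \<Rightarrow> 'a \<Rightarrow> real) set set" where
  "H2 br = coh_class br ` closed_two_forms br"

definition wedge ::
  "('a \<Rightarrow> 'a \<Rightarrow> real) \<Rightarrow> ('a \<Rightarrow> 'a \<Rightarrow> real) \<Rightarrow> 'a \<Rightarrow> 'a \<Rightarrow> 'a \<Rightarrow> 'a \<Rightarrow> real" where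
  "wedge \<alpha> \<beta> = (\<lambda>x y z w.
     \<alpha> x y * \<beta> z w - \<alpha> x z * \<beta> y w + \<alpha> x w * \<beta> y z
     + \<alpha> y z * \<beta> x w - \<alpha> y w * \<beta> x z + \<alpha> z w * \<beta> x y)"

text \<open>In dimension four the nonzero elements of \<open>\<Lambda>\<^sup>4\<close> are exactly the products
  \<open>\<zeta> 0 \<and> \<zeta> 1 \<and> \<zeta> 2 \<and> \<zeta> 3\<close> of a basis, and evaluating a \<open>4\<close>-form on such a product is evaluating
  it on the four vectors.\<close>

definition four_vector_basis :: "(nat \<Rightarrow> 'a::real_vector) \<Rightarrow> bool" where
  "four_vector_basis \<zeta> \<longleftrightarrow>
     inj_on \<zeta> {..<4} \<and> independent (\<zeta> ` {..<4}) \<and> span (\<zeta> ` {..<4}) = UNIV"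

definition pairing ::
  "(nat \<Rightarrow> 'a) \<Rightarrow> ('a \<Rightarrow> 'a \<Rightarrow> real) \<Rightarrow> ('a \<Rightarrow> 'a \<Rightarrow> real) \<Rightarrow> real" where
  "pairing \<zeta> \<alpha> \<beta> = wedge \<alpha> \<beta> (\<zeta> 0) (\<zeta> 1) (\<zeta> 2) (\<zeta> 3)"

text \<open>The value of the induced form on a class is its value on any representative: for unimodular
  algebras of dimension four, the wedge product of a closed and an exact form vanishes.\<close>

definition positive_definite_on ::
  "('a::real_vector \<Rightarrow> 'a \<Rightarrow> 'a) \<Rightarrow> (nat \<Rightarrow> 'a) \<Rightarrow> ('a \<Rightarrow> 'a \<Rightarrow> real) set set \<Rightarrow> bool" where
  "positive_definite_on br \<zeta> W \<longleftrightarrow>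
     (\<forall>C\<in>W. C \<noteq> coh_class br 0 \<longrightarrow> (\<forall>\<alpha>\<in>C. 0 < pairing \<zeta> \<alpha> \<alpha>))"

text \<open>The pairing has signature \<open>(b_plus, b_plus)\<close> for unimodular algebras of dimension four, so
  reversing the orientation given by \<open>\<zeta>\<close> does not change \<open>b_plus\<close>.\<close>

definition b_plus :: "('a::real_vector \<Rightarrow> 'a \<Rightarrow> 'a) \<Rightarrow> (nat \<Rightarrow> 'a) \<Rightarrow> nat" where
  "b_plus br \<zeta> = Max {quot_dim (exact_two_forms br) W | W.
     W \<subseteq> H2 br \<and> quot_subspace (exact_two_forms br) W \<and> positive_definite_on br \<zeta> W}"

section \<open>Almost complex structures\<close>

definition almost_complex :: "('a::real_vector \<Rightarrow> 'a) \<Rightarrow> bool" where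
  "almost_complex J \<longleftrightarrow> linear J \<and> (\<forall>v. J (J v) = - v)"

definition integrable_acs :: "('a::real_vector \<Rightarrow> 'a \<Rightarrow> 'a) \<Rightarrow> ('a \<Rightarrow> 'a) \<Rightarrow> bool" where
  "integrable_acs br J \<longleftrightarrow>
     (\<forall>u v. br u v + J (br (J u) v) + J (br u (J v)) - br (J u) (J v) = 0)"

definition Lambda_minus :: "('a::real_vector \<Rightarrow> 'a) \<Rightarrow> ('a \<Rightarrow> 'a \<Rightarrow> real) set" where
  "Lambda_minus J = {\<alpha> \<in> two_forms. \<forall>u v. \<alpha> (J u) (J v) = - \<alpha> u v}"

definition H_minus ::
  "('a::real_vector \<Rightarrow> 'a \<Rightarrow> 'a) \<Rightarrow> ('a \<Rightarrow> 'a) \<Rightarrow> ('a \<Rightarrow> 'a \<Rightarrow> real) set set" where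
  "H_minus br J = coh_class br ` (closed_two_forms br \<inter> Lambda_minus J)"

definition h_minus :: "('a::real_vector \<Rightarrow> 'a \<Rightarrow> 'a) \<Rightarrow> ('a \<Rightarrow> 'a) \<Rightarrow> nat" where
  "h_minus br J = quot_dim (exact_two_forms br) (H_minus br J)"

definition tamed :: "('a::real_vector \<Rightarrow> 'a \<Rightarrow> 'a) \<Rightarrow> ('a \<Rightarrow> 'a) \<Rightarrow> bool" where
  "tamed br J \<longleftrightarrow> (\<exists>\<phi>\<in>closed_two_forms br. \<forall>v. v \<noteq> 0 \<longrightarrow> 0 < \<phi> v (J v))"

end

theory Submission
  imports Defs
begin

text \<open>
  Write \<open>B\<close> for the exact and \<open>Z\<close> for the closed \<open>2\<close>-forms, and let orthogonality of
  \<open>2\<close>-forms refer to the wedge pairing, which has signature \<open>(3, 3)\<close>. Unimodularity says that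
  \<open>d\<close> vanishes on \<open>3\<close>-forms, so \<open>d \<phi> \<and> \<alpha> = \<phi> \<and> d \<alpha>\<close> for \<open>1\<close>-forms \<open>\<phi>\<close> and \<open>2\<close>-forms \<open>\<alpha>\<close>; hence
  \<open>Z\<close> is the orthogonal complement of \<open>B\<close> (\<open>closed_forms_eq_nperp_exact\<close>). By the Jacobi
  identity \<open>B \<subseteq> Z\<close>, so \<open>B\<close> is isotropic and the pairing descends to \<open>Z / B\<close> with signature
  \<open>(3 - dim B, 3 - dim B)\<close>. Thus the three cases of the theorem are \<open>dim B = 0, 1, 2\<close>
  (\<open>b_plus_add_dim_exact\<close>).

  An almost complex structure \<open>J\<close> splits the \<open>2\<close>-forms orthogonally into the invariant forms
  \<open>\<Lambda>\<^sup>+\<close> and the anti-invariant forms \<open>\<Lambda>\<^sup>-\<close>; the latter are a definite plane. Everything is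
  governed by the number \<open>r = dim (B \<inter> \<Lambda>\<^sup>+)\<close>:

  \<^item> Since \<open>Z \<inter> \<Lambda>\<^sup>-\<close> is the orthogonal complement of \<open>B + \<Lambda>\<^sup>+\<close>, its dimension is
    \<open>2 - dim B + r\<close> (\<open>dim_closed_anti_invariant\<close>). It meets \<open>B\<close> trivially, as \<open>\<Lambda>\<^sup>-\<close> is
    definite and \<open>B\<close> isotropic, so this is also the dimension of its image in cohomology.
  \<^item> \<open>J\<close> is tamed if and only if \<open>r = 0\<close> (\<open>tamed_iff_no_invariant_exact_form\<close>). The space
    \<open>Z + \<Lambda>\<^sup>-\<close> is the orthogonal complement of \<open>B \<inter> \<Lambda>\<^sup>+\<close>; if the latter is zero, any
    invariant taming form can be corrected by an anti-invariant form, invisible to taming, to a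
    closed form. Conversely, an element of \<open>B \<inter> \<Lambda>\<^sup>+\<close> is a null vector of the Lorentzian space
    \<open>\<Lambda>\<^sup>+\<close>, and it is orthogonal to the invariant part of a taming form, which is timelike.
  \<^item> If \<open>dim B = 1\<close>, then \<open>[u, v] = \<beta>(u, v) w\<close> with \<open>B\<close> spanned by \<open>\<beta>\<close>, and the Nijenhuis
    condition says precisely that \<open>\<beta>\<close> is \<open>J\<close>-invariant, that is, \<open>r = 1\<close>.
\<close>

section \<open>Dimensions in quotient spaces\<close>

lemma dim_image_inj_on:
  fixes f :: "'a::real_vector \<Rightarrow> 'b::real_vector"
  assumes "linear f" "subspace V" "inj_on f V"
  shows "dim (f ` V) = dim V"
proof -
  obtain b where b: "b \<subseteq> V" "independent b" "V \<subseteq> span b" "card b = dim V"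
    using basis_exists by blast
  have V: "span b = V"
    using b assms(2) by (simp add: span_subspace)
  have "independent (f ` b)"
    using linear_independent_injective_image[OF assms(1) b(2)] assms(3) V by simp
  moreover have "span (f ` b) = f ` V"
    using linear_span_image[OF assms(1)] V by metis
  moreover have "card (f ` b) = dim V"
    using b assms(3) by (metis card_image inj_on_subset)
  ultimately show ?thesis
    by (metis dim_span_eq_card_independent)
qed

lemma coset_0 [simp]: "coset B 0 = B"
  by (auto simp: coset_def)

lemma in_coset_iff: "y \<in> coset B x \<longleftrightarrow> y - x \<in> B"
  by (auto simp: coset_def intro: exI[of _ "y - x"])

lemma coset_eq_iff:
  assumes "subspace B"
  shows "coset B x = coset B y \<longleftrightarrow> x - y \<in> B"
proof
  assume "coset B x = coset B y"
  then show "x - y \<in> B"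
    using assms by (metis in_coset_iff diff_self subspace_0)
next
  assume *: "x - y \<in> B"
  have "z - x \<in> B \<longleftrightarrow> z - y \<in> B" for z
    using subspace_add[OF assms, of "z - x" "x - y"] subspace_diff[OF assms, of "z - y" "x - y"] *
    by auto
  then show "coset B x = coset B y"
    by (auto simp: in_coset_iff)
qed

lemma coset_eq_self_iff: "subspace B \<Longrightarrow> coset B x = B \<longleftrightarrow> x \<in> B"
  using coset_eq_iff[of B x 0] by simp

text \<open>A linear relation between the representatives, or an element of \<open>B\<close> in their span, would be
  a relation between the cosets.\<close>
lemma quot_independent_representatives:
  fixes B :: "'v::real_vector set"
  assumes B: "subspace B" and S: "finite S" "S \<subseteq> range (coset B)" "quot_independent B S"
    and f: "\<And>C. C \<in> S \<Longrightarrow> f C \<in> C"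
  shows "inj_on f S" "independent (f ` S)" "span (f ` S) \<inter> B = {0}"
proof -
  have coset_f: "coset B (f C) = C" if "C \<in> S" for C
  proof -
    obtain x where x: "C = coset B x"
      using S(2) \<open>C \<in> S\<close> by blast
    then show ?thesis
      using f[OF that] by (simp add: in_coset_iff coset_eq_iff[OF B])
  qed
  show inj: "inj_on f S"
    by (metis inj_onI coset_f)
  have zero: "a (f C) = 0" if "(\<Sum>v\<in>f ` S. a v *\<^sub>R v) \<in> B" "C \<in> S" for a C
  proof -
    have "(\<Sum>v\<in>f ` S. a v *\<^sub>R v) = (\<Sum>C\<in>S. a (f C) *\<^sub>R f C)"
      using inj by (simp add: sum.reindex)
    then have "coset B (\<Sum>C\<in>S. a (f C) *\<^sub>R f C) = coset B 0"
      using that(1) coset_eq_self_iff[OF B] by simp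
    moreover have "\<forall>C\<in>S. f C \<in> C"
      using f by blast
    ultimately show ?thesis
      using S(3)[unfolded quot_independent_def, rule_format, of f "\<lambda>C. a (f C)"] that(2) by blast
  qed
  show "independent (f ` S)"
    using zero subspace_0[OF B] S(1) by (intro independent_if_scalars_zero) auto
  have "v = 0" if v: "v \<in> span (f ` S)" "v \<in> B" for v
  proof -
    obtain a where a: "v = (\<Sum>v\<in>f ` S. a v *\<^sub>R v)"
      using v(1) S(1) by (auto simp: span_finite)
    then show ?thesis
      using zero[of a] v(2) by (auto intro!: sum.neutral)
  qed
  then show "span (f ` S) \<inter> B = {0}"
    using subspace_0[OF B] by (auto simp: span_zero)
qed

lemma quot_dim_eqI:
  assumes "\<And>S. finite S \<Longrightarrow> S \<subseteq> W \<Longrightarrow> quot_independent B S \<Longrightarrow> card S \<le> n"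
    and "finite S" "S \<subseteq> W" "quot_independent B S" "card S = n"
  shows "quot_dim B W = n"
proof -
  have "{card S | S. finite S \<and> S \<subseteq> W \<and> quot_independent B S} \<subseteq> {..n}"
    using assms(1) by auto
  then show ?thesis
    unfolding quot_dim_def using assms(2-) by (intro Max_eqI) (auto dest: finite_subset)
qed

lemma quot_dim_le:
  assumes "\<And>S. finite S \<Longrightarrow> S \<subseteq> W \<Longrightarrow> quot_independent B S \<Longrightarrow> card S \<le> n"
  shows "quot_dim B W \<le> n"
proof -
  let ?D = "{card S | S. finite S \<and> S \<subseteq> W \<and> quot_independent B S}"
  have "?D \<subseteq> {..n}"
    using assms by auto
  moreover have "0 \<in> ?D"
    by (auto simp: quot_independent_def intro!: exI[of _ "{}"])
  ultimately show ?thesis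
    unfolding quot_dim_def by (subst Max_le_iff) (auto dest: finite_subset)
qed

text \<open>The quotient map is injective on a subspace meeting \<open>B\<close> trivially, so it preserves the
  dimension. The finite spanning set makes the maximum in \<^const>\<open>quot_dim\<close> exist.\<close>
lemma quot_dim_coset_image:
  fixes B V :: "'v::real_vector set"
  assumes B: "subspace B" and V: "subspace V" "V \<inter> B = {0}"
    and b: "finite b" "V \<subseteq> span b"
  shows "quot_dim B (coset B ` V) = dim V"
proof -
  obtain c where c: "c \<subseteq> V" "independent c" "V \<subseteq> span c" "card c = dim V"
    using basis_exists by blast
  have fin_c: "finite c"
    using independent_span_bound[OF b(1) c(2)] c(1) b(2) by blast
  have inj: "inj_on (coset B) V"
  proof (rule inj_onI)
    fix x y assume "x \<in> V" "y \<in> V" "coset B x = coset B y"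
    then have "x - y \<in> V \<inter> B"
      using subspace_diff[OF V(1)] by (simp add: coset_eq_iff[OF B])
    then show "x = y"
      using V(2) by simp
  qed
  show ?thesis
  proof (rule quot_dim_eqI)
    fix S assume S: "finite S" "S \<subseteq> coset B ` V" "quot_independent B S"
    define f where "f C = (SOME v. v \<in> V \<and> coset B v = C)" for C
    have f: "f C \<in> V" "coset B (f C) = C" if "C \<in> S" for C
      using someI_ex[of "\<lambda>v. v \<in> V \<and> coset B v = C"] that S(2) by (auto simp: f_def)
    have "f C \<in> C" if "C \<in> S" for C
      using f(2)[OF that] subspace_0[OF B] in_coset_iff[of "f C" B "f C"] by simp
    moreover have "S \<subseteq> range (coset B)"
      using S(2) by auto
    ultimately have "inj_on f S" "independent (f ` S)"
      using quot_independent_representatives[OF B S(1) _ S(3), of f] by auto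
    moreover have "f ` S \<subseteq> span c"
      using f(1) c(3) by auto
    ultimately show "card S \<le> dim V"
      using independent_span_bound[OF fin_c, of "f ` S"] c(4) by (simp add: card_image)
  next
    show "finite (coset B ` c)" "coset B ` c \<subseteq> coset B ` V"
      using fin_c c(1) by auto
    have inj_c: "inj_on (coset B) c"
      using inj c(1) by (rule inj_on_subset)
    show "card (coset B ` c) = dim V"
      using inj_c c(4) by (simp add: card_image)
    show "quot_independent B (coset B ` c)"
      unfolding quot_independent_def
    proof (intro allI impI)
      fix a f
      assume f: "\<forall>C\<in>coset B ` c. f C \<in> C"
        and sum: "coset B (\<Sum>C\<in>coset B ` c. a C *\<^sub>R f C) = coset B 0"
      have sum': "(\<Sum>v\<in>c. a (coset B v) *\<^sub>R f (coset B v)) \<in> B"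
        using sum by (simp add: coset_eq_self_iff[OF B] sum.reindex[OF inj_c])
      have "(\<Sum>v\<in>c. a (coset B v) *\<^sub>R (f (coset B v) - v)) \<in> B"
        using f by (intro subspace_sum[OF B] subspace_scale[OF B]) (auto simp: in_coset_iff)
      from subspace_diff[OF B sum' this] have "(\<Sum>v\<in>c. a (coset B v) *\<^sub>R v) \<in> B"
        by (simp add: scaleR_diff_right sum_subtractf)
      moreover have "(\<Sum>v\<in>c. a (coset B v) *\<^sub>R v) \<in> V"
        using c(1) by (intro subspace_sum[OF V(1)] subspace_scale[OF V(1)]) auto
      ultimately have "(\<Sum>v\<in>c. a (coset B v) *\<^sub>R v) = 0"
        using V(2) by auto
      then show "\<forall>C\<in>coset B ` c. a C = 0"
        using independentD[OF c(2) fin_c order_refl, of "\<lambda>v. a (coset B v)"] by auto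
    qed
  qed
qed

section \<open>The neutral inner product\<close>

text \<open>The symmetric form \<open>(x, y) \<cdot> (x', y') = x \<bullet> y' + y \<bullet> x'\<close> on a doubled Euclidean space is the
  model for the wedge pairing. Writing it as the Euclidean inner product with a swapped argument
  makes the orthogonal complement an isometric copy of the Euclidean one, which gives its
  dimension and the double complement law.\<close>
definition nperp :: "('e::euclidean_space \<times> 'e) set \<Rightarrow> ('e \<times> 'e) set" where
  "nperp U = {z. \<forall>u\<in>U. u \<bullet> prod.swap z = 0}"

lemma inner_swap_commute: "x \<bullet> prod.swap y = y \<bullet> prod.swap (x::'e::euclidean_space \<times> 'e)"
  by (cases x; cases y) (simp add: inner_commute add.commute)

lemma linear_swap: "linear (prod.swap :: 'e::euclidean_space \<times> 'e \<Rightarrow> _)"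
  by (auto intro!: linearI)

lemma nperp_eq_swap_image: "nperp U = prod.swap ` (U\<^sup>\<bottom>)"
proof -
  have "z \<in> nperp U \<longleftrightarrow> prod.swap z \<in> U\<^sup>\<bottom>" for z
    by (auto simp: nperp_def orthogonal_comp_def orthogonal_def)
  then show ?thesis
    by (force intro!: image_eqI)
qed

lemma subspace_nperp: "subspace (nperp U)"
  unfolding nperp_eq_swap_image
  by (intro linear_subspace_image linear_swap subspace_orthogonal_comp)

lemma dim_nperp:
  fixes U :: "('e::euclidean_space \<times> 'e) set"
  assumes "subspace U"
  shows "dim (nperp U) + dim U = 2 * DIM('e)"
proof -
  have "dim (nperp U) = dim (U\<^sup>\<bottom>)"
    unfolding nperp_eq_swap_image
    by (intro dim_image_inj_on linear_swap subspace_orthogonal_comp) (auto simp: inj_on_def)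
  moreover have "dim (U\<^sup>\<bottom>) + dim U = dim (UNIV :: ('e \<times> 'e) set)"
    using dim_subspace_orthogonal_to_vectors[OF assms subspace_UNIV] 
    by (simp add: orthogonal_comp_def)
  ultimately show ?thesis
    by simp
qed

lemma nperp_nperp:
  assumes "subspace U"
  shows "nperp (nperp U) = U"
proof -
  have "U \<subseteq> nperp (nperp U)"
  proof
    fix u assume "u \<in> U"
    then have "z \<bullet> prod.swap u = 0" if "z \<in> nperp U" for z
      using that inner_swap_commute[of z u] by (simp add: nperp_def)
    then show "u \<in> nperp (nperp U)"
      by (simp add: nperp_def)
  qed
  moreover have "dim (nperp (nperp U)) = dim U"
    using dim_nperp[OF assms] dim_nperp[OF subspace_nperp, of U] by simp
  ultimately show ?thesis
    using subspace_dim_equal[OF assms subspace_nperp, of "nperp U"] by simp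
qed

lemma nperp_Int:
  assumes "subspace U" "subspace V"
  shows "nperp U \<inter> nperp V = nperp {x + y |x y. x \<in> U \<and> y \<in> V}" (is "_ = nperp ?S")
proof
  show "nperp U \<inter> nperp V \<subseteq> nperp ?S"
  proof
    fix z assume "z \<in> nperp U \<inter> nperp V"
    then have "(x + y) \<bullet> prod.swap z = 0" if "x \<in> U" "y \<in> V" for x y
      using that by (simp add: nperp_def inner_add_left del: swap_simp inner_Pair)
    then show "z \<in> nperp ?S"
      unfolding nperp_def by blast
  qed
  have "u \<in> ?S" if "u \<in> U" for u
    using that subspace_0[OF assms(2)] by (intro CollectI exI[of _ u] exI[of _ 0]) simp
  moreover have "v \<in> ?S" if "v \<in> V" for v
    using that subspace_0[OF assms(1)] by (intro CollectI exI[of _ 0] exI[of _ v]) simp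
  ultimately show "nperp ?S \<subseteq> nperp U \<inter> nperp V"
    unfolding nperp_def by blast
qed

section \<open>Two-forms in coordinates\<close>

definition dual_coord :: "(nat \<Rightarrow> 'a::real_vector) \<Rightarrow> nat \<Rightarrow> 'a \<Rightarrow> real" where
  "dual_coord \<zeta> k v = representation (\<zeta> ` {..<4}) v (\<zeta> k)"

lemma lessThan_4: "{..<4::nat} = {0, 1, 2, 3}"
  by auto

lemma linear_dual_coord: "four_vector_basis \<zeta> \<Longrightarrow> linear (dual_coord \<zeta> k)"
  unfolding dual_coord_def four_vector_basis_def
  by (auto intro!: linearI simp: representation_add representation_scale)

lemma dual_coord_basis:
  "four_vector_basis \<zeta> \<Longrightarrow> j < 4 \<Longrightarrow> k < 4 \<Longrightarrow> dual_coord \<zeta> k (\<zeta> j) = (if j = k then 1 else 0)"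
  unfolding dual_coord_def four_vector_basis_def
  by (auto simp: representation_basis inj_on_eq_iff)

lemma dual_coord_basis_numerals:
  assumes "four_vector_basis \<zeta>"
  shows "dual_coord \<zeta> 0 (\<zeta> 0) = 1" "dual_coord \<zeta> 0 (\<zeta> 1) = 0"
    "dual_coord \<zeta> 0 (\<zeta> 2) = 0" "dual_coord \<zeta> 0 (\<zeta> 3) = 0"
    "dual_coord \<zeta> 1 (\<zeta> 0) = 0" "dual_coord \<zeta> 1 (\<zeta> 1) = 1"
    "dual_coord \<zeta> 1 (\<zeta> 2) = 0" "dual_coord \<zeta> 1 (\<zeta> 3) = 0"
    "dual_coord \<zeta> 2 (\<zeta> 0) = 0" "dual_coord \<zeta> 2 (\<zeta> 1) = 0"
    "dual_coord \<zeta> 2 (\<zeta> 2) = 1" "dual_coord \<zeta> 2 (\<zeta> 3) = 0"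
    "dual_coord \<zeta> 3 (\<zeta> 0) = 0" "dual_coord \<zeta> 3 (\<zeta> 1) = 0"
    "dual_coord \<zeta> 3 (\<zeta> 2) = 0" "dual_coord \<zeta> 3 (\<zeta> 3) = 1"
  using dual_coord_basis[OF assms] by auto

lemma basis_expansion:
  assumes "four_vector_basis \<zeta>"
  shows "v = dual_coord \<zeta> 0 v *\<^sub>R \<zeta> 0 + dual_coord \<zeta> 1 v *\<^sub>R \<zeta> 1
           + dual_coord \<zeta> 2 v *\<^sub>R \<zeta> 2 + dual_coord \<zeta> 3 v *\<^sub>R \<zeta> 3"
proof -
  have "v = (\<Sum>b\<in>\<zeta> ` {..<4}. representation (\<zeta> ` {..<4}) v b *\<^sub>R b)"
    using assms by (subst real_vector.sum_representation_eq) (auto simp: four_vector_basis_def)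
  also have "\<dots> = (\<Sum>k<4. dual_coord \<zeta> k v *\<^sub>R \<zeta> k)"
    using assms by (simp add: four_vector_basis_def sum.reindex dual_coord_def)
  finally show ?thesis
    by (simp add: lessThan_4 add.assoc)
qed

lemma linear_eq_on_basis:
  assumes "four_vector_basis \<zeta>" "linear f" "linear g"
    and "f (\<zeta> 0) = g (\<zeta> 0)" "f (\<zeta> 1) = g (\<zeta> 1)" "f (\<zeta> 2) = g (\<zeta> 2)" "f (\<zeta> 3) = g (\<zeta> 3)"
  shows "f = g"
proof
  fix v
  have "v \<in> span (\<zeta> ` {..<4})"
    using assms(1) by (simp add: four_vector_basis_def)
  then show "f v = g v"
    by (rule linear_eq_on[OF assms(2,3)]) (use assms(4-) in \<open>auto simp: lessThan_4\<close>)
qed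

lemma two_form_bilinear: "\<alpha> \<in> two_forms \<Longrightarrow> bilinear \<alpha>"
  and two_form_diag: "\<alpha> \<in> two_forms \<Longrightarrow> \<alpha> u u = 0"
  by (auto simp: two_forms_def)

lemma bilinear_alternating_antisym:
  assumes h: "bilinear h" "\<And>u. h u u = 0"
  shows "h u v = - h v u"
proof -
  have "h u v + h v u = 0"
    using h(2)[of "u + v"] h(2)[of u] h(2)[of v]
    by (simp add: bilinear_ladd[OF h(1)] bilinear_radd[OF h(1)] add.commute)
  then show ?thesis
    by (simp add: eq_neg_iff_add_eq_0)
qed

lemma two_form_antisym: "\<alpha> \<in> two_forms \<Longrightarrow> \<alpha> u v = - \<alpha> v u"
  by (rule bilinear_alternating_antisym[OF two_form_bilinear two_form_diag])

lemma subspace_two_forms: "subspace (two_forms :: ('a::real_vector \<Rightarrow> 'a \<Rightarrow> real) set)"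
proof -
  let ?T = "two_forms :: ('a \<Rightarrow> 'a \<Rightarrow> real) set"
  have "(\<lambda>_ _. 0) \<in> ?T"
    by (auto simp: two_forms_def bilinear_def linear_iff)
  moreover have "(\<lambda>u v. \<alpha> u v + \<beta> u v) \<in> two_forms" if "\<alpha> \<in> ?T" "\<beta> \<in> ?T" for \<alpha> \<beta>
    using that by (auto simp: two_forms_def bilinear_def linear_iff distrib_left)
  moreover have "(\<lambda>u v. c * \<alpha> u v) \<in> two_forms" if "\<alpha> \<in> ?T" for c \<alpha>
    using that by (auto simp: two_forms_def bilinear_def linear_iff distrib_left)
  ultimately show ?thesis
    by (simp add: subspace_def zero_fun_def plus_fun_def scaleR_fun_def)
qed

text \<open>The order and the sign of the last three coordinates are chosen so that the wedge pairing
  becomes the neutral form of the previous section.\<close>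
definition form_coords ::
  "(nat \<Rightarrow> 'a) \<Rightarrow> ('a \<Rightarrow> 'a \<Rightarrow> real) \<Rightarrow> (real \<times> real \<times> real) \<times> (real \<times> real \<times> real)" where
  "form_coords \<zeta> \<alpha> =
     ((\<alpha> (\<zeta> 0) (\<zeta> 1), \<alpha> (\<zeta> 0) (\<zeta> 2), \<alpha> (\<zeta> 0) (\<zeta> 3)),
      (\<alpha> (\<zeta> 2) (\<zeta> 3), - \<alpha> (\<zeta> 1) (\<zeta> 3), \<alpha> (\<zeta> 1) (\<zeta> 2)))"

lemma linear_form_coords: "linear (form_coords \<zeta>)"
proof (rule linearI)
  show "form_coords \<zeta> (\<alpha> + \<beta>) = form_coords \<zeta> \<alpha> + form_coords \<zeta> \<beta>" for \<alpha> \<beta>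
    by (simp add: form_coords_def plus_fun_def)
  show "form_coords \<zeta> (c *\<^sub>R \<alpha>) = c *\<^sub>R form_coords \<zeta> \<alpha>" for c \<alpha>
    by (simp add: form_coords_def scaleR_fun_def)
qed

lemma pairing_form_coords: "pairing \<zeta> \<alpha> \<beta> = form_coords \<zeta> \<alpha> \<bullet> prod.swap (form_coords \<zeta> \<beta>)"
  by (simp add: pairing_def wedge_def form_coords_def)

lemma two_form_eqI:
  assumes \<zeta>: "four_vector_basis \<zeta>" and "\<alpha> \<in> two_forms" "\<beta> \<in> two_forms"
    and "form_coords \<zeta> \<alpha> = form_coords \<zeta> \<beta>"
  shows "\<alpha> = \<beta>"
proof -
  have "\<alpha> u v = \<beta> u v" for u v
  proof (rule bilinear_eq[of \<alpha> \<beta> UNIV "\<zeta> ` {..<4}" UNIV "\<zeta> ` {..<4}"])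
    fix x y assume xy: "x \<in> \<zeta> ` {..<4}" "y \<in> \<zeta> ` {..<4}"
    note antisym = two_form_antisym[OF assms(2), of "\<zeta> 1" "\<zeta> 0"]
      two_form_antisym[OF assms(2), of "\<zeta> 2" "\<zeta> 0"] two_form_antisym[OF assms(2), of "\<zeta> 3" "\<zeta> 0"]
      two_form_antisym[OF assms(2), of "\<zeta> 2" "\<zeta> 1"] two_form_antisym[OF assms(2), of "\<zeta> 3" "\<zeta> 1"]
      two_form_antisym[OF assms(2), of "\<zeta> 3" "\<zeta> 2"]
      two_form_antisym[OF assms(3), of "\<zeta> 1" "\<zeta> 0"]
      two_form_antisym[OF assms(3), of "\<zeta> 2" "\<zeta> 0"] two_form_antisym[OF assms(3), of "\<zeta> 3" "\<zeta> 0"]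
      two_form_antisym[OF assms(3), of "\<zeta> 2" "\<zeta> 1"] two_form_antisym[OF assms(3), of "\<zeta> 3" "\<zeta> 1"]
      two_form_antisym[OF assms(3), of "\<zeta> 3" "\<zeta> 2"]
    show "\<alpha> x y = \<beta> x y"
      using xy assms(4) antisym two_form_diag[OF assms(2)] two_form_diag[OF assms(3)]
      by (auto simp: lessThan_4 form_coords_def)
  qed (use assms in \<open>auto simp: two_form_bilinear four_vector_basis_def\<close>)
  then show ?thesis
    by (intro ext)
qed

lemma inj_on_form_coords: "four_vector_basis \<zeta> \<Longrightarrow> inj_on (form_coords \<zeta>) two_forms"
  by (rule inj_onI) (rule two_form_eqI)

definition wedge_covectors :: "('a \<Rightarrow> real) \<Rightarrow> ('a \<Rightarrow> real) \<Rightarrow> 'a \<Rightarrow> 'a \<Rightarrow> real" where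
  "wedge_covectors \<phi> \<psi> = (\<lambda>u v. \<phi> u * \<psi> v - \<phi> v * \<psi> u)"

lemma wedge_covectors_two_form:
  "linear \<phi> \<Longrightarrow> linear \<psi> \<Longrightarrow> wedge_covectors \<phi> \<psi> \<in> two_forms"
proof -
  assume "linear \<phi>" "linear \<psi>"
  then show ?thesis
    by (auto simp: wedge_covectors_def two_forms_def bilinear_def linear_iff algebra_simps)
qed

lemma form_coords_surj:
  assumes \<zeta>: "four_vector_basis \<zeta>"
  shows "form_coords \<zeta> ` two_forms = UNIV"
proof -
  have "p \<in> form_coords \<zeta> ` two_forms" for p
  proof -
    obtain x1 x2 x3 y1 y2 y3 where p: "p = ((x1, x2, x3), (y1, y2, y3))"
      by (metis prod.collapse)
    let ?w = "\<lambda>i j. wedge_covectors (dual_coord \<zeta> i) (dual_coord \<zeta> j)"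
    define \<alpha> where "\<alpha> = x1 *\<^sub>R ?w 0 1 + x2 *\<^sub>R ?w 0 2 + x3 *\<^sub>R ?w 0 3
      + y1 *\<^sub>R ?w 2 3 - y2 *\<^sub>R ?w 1 3 + y3 *\<^sub>R ?w 1 2"
    have "\<alpha> \<in> two_forms"
      unfolding \<alpha>_def
      by (intro subspace_add subspace_diff subspace_scale subspace_two_forms
          wedge_covectors_two_form linear_dual_coord \<zeta>)
    moreover have "form_coords \<zeta> \<alpha> = p"
      using dual_coord_basis_numerals[OF \<zeta>]
      by (simp add: p \<alpha>_def form_coords_def wedge_covectors_def plus_fun_def fun_diff_def scaleR_fun_def)
    ultimately show ?thesis
      by blast
  qed
  then show ?thesis
    by auto
qed

lemma dim_form_coords_image:
  assumes "four_vector_basis \<zeta>" "subspace V" "V \<subseteq> two_forms"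
  shows "dim (form_coords \<zeta> ` V) = dim V"
  using inj_on_subset[OF inj_on_form_coords[OF assms(1)] assms(3)]
  by (rule dim_image_inj_on[OF linear_form_coords assms(2)])

lemma form_coords_image_Int:
  assumes "four_vector_basis \<zeta>" "V \<subseteq> two_forms" "W \<subseteq> two_forms"
  shows "form_coords \<zeta> ` (V \<inter> W) = form_coords \<zeta> ` V \<inter> form_coords \<zeta> ` W"
  using assms(2,3) by (rule inj_on_image_Int[OF inj_on_form_coords[OF assms(1)]])

lemma two_forms_finitely_spanned:
  assumes "four_vector_basis (\<zeta> :: nat \<Rightarrow> 'a::real_vector)"
  obtains b where "finite b" "(two_forms :: ('a \<Rightarrow> 'a \<Rightarrow> real) set) \<subseteq> span b"
proof -
  obtain b :: "('a \<Rightarrow> 'a \<Rightarrow> real) set"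
    where b: "b \<subseteq> two_forms" "independent b" "two_forms \<subseteq> span b"
    using basis_exists[of two_forms] by metis
  have span: "span b = two_forms"
    using b(1,3) subspace_two_forms by (rule span_subspace)
  have "independent (form_coords \<zeta> ` b)"
    using linear_independent_injective_image[OF linear_form_coords b(2)] inj_on_form_coords[OF assms] span
    by simp
  then have "finite (form_coords \<zeta> ` b)"
    by (rule independent_imp_finite)
  then have "finite b"
    using inj_on_subset[OF inj_on_form_coords[OF assms] b(1)] by (simp add: finite_image_iff)
  then show ?thesis
    using that b(3) by blast
qed

section \<open>Closed forms are the forms orthogonal to the exact ones\<close>

text \<open>The trace does not depend on the basis: expand each element of the one basis in the other and
  exchange the two sums.\<close>
lemma lin_trace_eq:
  fixes f :: "'a::real_vector \<Rightarrow> 'a"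
  assumes \<zeta>: "four_vector_basis \<zeta>" and f: "linear f"
  shows "lin_trace f = (\<Sum>k<4. dual_coord \<zeta> k (f (\<zeta> k)))"
proof -
  let ?B = "extend_basis {} :: 'a set"
  let ?R = "representation ?B"
  have B: "independent ?B" "span ?B = UNIV"
    by (simp_all add: independent_extend_basis independent_empty span_extend_basis)
  have "finite ?B"
    using independent_span_bound[OF _ B(1), of "\<zeta> ` {..<4}"] \<zeta> by (simp add: four_vector_basis_def)
  have R: "(\<Sum>b\<in>?B. ?R v b *\<^sub>R b) = v" for v
    using B \<open>finite ?B\<close> by (intro real_vector.sum_representation_eq) auto
  have linear_R: "linear (\<lambda>v. ?R v b)" for b
    using B by (auto intro!: linearI simp: representation_add representation_scale)
  have expansion: "b = (\<Sum>k<4. dual_coord \<zeta> k b *\<^sub>R \<zeta> k)" for b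
    using basis_expansion[OF \<zeta>, of b] by (simp add: lessThan_4 add.assoc)
  have "?R (f b) b = (\<Sum>k<4. dual_coord \<zeta> k b * ?R (f (\<zeta> k)) b)" for b
  proof -
    have "?R (f b) b = ?R (f (\<Sum>k<4. dual_coord \<zeta> k b *\<^sub>R \<zeta> k)) b"
      using expansion[of b] by simp
    also have "\<dots> = (\<Sum>k<4. dual_coord \<zeta> k b * ?R (f (\<zeta> k)) b)"
      by (simp add: linear_sum[OF linear_compose[OF f linear_R], unfolded o_def]
          linear_scale[OF linear_compose[OF f linear_R], unfolded o_def])
    finally show ?thesis .
  qed
  then have "lin_trace f = (\<Sum>b\<in>?B. \<Sum>k<4. dual_coord \<zeta> k b * ?R (f (\<zeta> k)) b)"
    by (simp add: lin_trace_def)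
  also have "\<dots> = (\<Sum>k<4. \<Sum>b\<in>?B. ?R (f (\<zeta> k)) b *\<^sub>R dual_coord \<zeta> k b)"
    by (subst sum.swap) (simp add: mult.commute)
  also have "\<dots> = (\<Sum>k<4. dual_coord \<zeta> k (\<Sum>b\<in>?B. ?R (f (\<zeta> k)) b *\<^sub>R b))"
    by (simp add: linear_sum[OF linear_dual_coord[OF \<zeta>]] linear_scale[OF linear_dual_coord[OF \<zeta>]])
  also have "\<dots> = (\<Sum>k<4. dual_coord \<zeta> k (f (\<zeta> k)))"
    by (simp add: R)
  finally show ?thesis .
qed

lemma lie_algebra_bilinear: "lie_algebra br \<Longrightarrow> bilinear br"
  and lie_algebra_diag: "lie_algebra br \<Longrightarrow> br u u = 0"
  and lie_algebra_jacobi: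
    "lie_algebra br \<Longrightarrow> br u (br v w) + br v (br w u) + br w (br u v) = 0"
  by (auto simp: lie_algebra_def)

lemma lie_algebra_antisym: "lie_algebra br \<Longrightarrow> br u v = - br v u"
  by (rule bilinear_alternating_antisym[OF lie_algebra_bilinear lie_algebra_diag])

lemma subspace_exact: "subspace (exact_two_forms br)"
proof -
  have "subspace {\<phi> :: 'a \<Rightarrow> real. linear \<phi>}"
    unfolding subspace_def linear_iff
    by (auto simp: zero_fun_def plus_fun_def scaleR_fun_def algebra_simps)
  moreover have "linear (ce_d1 br)"
    by (intro linearI) (auto simp: ce_d1_def plus_fun_def scaleR_fun_def)
  ultimately show ?thesis
    unfolding exact_two_forms_def by (intro linear_subspace_image)
qed

lemma subspace_closed: "subspace (closed_two_forms br)"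
proof -
  have "subspace {\<alpha>. \<forall>u v w. ce_d2 br \<alpha> u v w = 0}"
  proof (rule subspaceI)
    show "0 \<in> {\<alpha>. \<forall>u v w. ce_d2 br \<alpha> u v w = 0}"
      by (simp add: ce_d2_def zero_fun_def)
    have add: "ce_d2 br (\<alpha> + \<beta>) u v w = ce_d2 br \<alpha> u v w + ce_d2 br \<beta> u v w" for \<alpha> \<beta> u v w
      by (simp add: ce_d2_def plus_fun_def)
    have scale: "ce_d2 br (c *\<^sub>R \<alpha>) u v w = c * ce_d2 br \<alpha> u v w" for c \<alpha> u v w
      by (simp add: ce_d2_def scaleR_fun_def algebra_simps)
    show "\<alpha> + \<beta> \<in> {\<alpha>. \<forall>u v w. ce_d2 br \<alpha> u v w = 0}"
      if "\<alpha> \<in> {\<alpha>. \<forall>u v w. ce_d2 br \<alpha> u v w = 0}" "\<beta> \<in> {\<alpha>. \<forall>u v w. ce_d2 br \<alpha> u v w = 0}" for \<alpha> \<beta>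
      using that by (simp add: add)
    show "c *\<^sub>R \<alpha> \<in> {\<alpha>. \<forall>u v w. ce_d2 br \<alpha> u v w = 0}"
      if "\<alpha> \<in> {\<alpha>. \<forall>u v w. ce_d2 br \<alpha> u v w = 0}" for c \<alpha>
      using that by (simp add: scale)
  qed
  moreover have "closed_two_forms br = two_forms \<inter> {\<alpha>. \<forall>u v w. ce_d2 br \<alpha> u v w = 0}"
    by (auto simp: closed_two_forms_def)
  ultimately show ?thesis
    by (simp add: subspace_inter subspace_two_forms)
qed

lemma closed_subset_two_forms: "closed_two_forms br \<subseteq> two_forms"
  by (auto simp: closed_two_forms_def)

lemma exact_subset_closed:
  assumes br: "lie_algebra br"
  shows "exact_two_forms br \<subseteq> closed_two_forms br"
proof
  fix \<alpha> assume "\<alpha> \<in> exact_two_forms br"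
  then obtain \<phi> where \<phi>: "linear \<phi>" "\<alpha> = ce_d1 br \<phi>"
    by (auto simp: exact_two_forms_def)
  have "\<alpha> \<in> two_forms"
    using \<phi>(1) lie_algebra_bilinear[OF br] lie_algebra_diag[OF br]
    by (auto simp: \<phi>(2) ce_d1_def two_forms_def bilinear_def linear_iff linear_0[OF \<phi>(1)])
  moreover have "ce_d2 br \<alpha> u v w = 0" for u v w
  proof -
    have "br (br u v) w - br (br u w) v + br (br v w) u
      = - (br u (br v w) + br v (br w u) + br w (br u v))"
      using lie_algebra_antisym[OF br, of "br u v" w] lie_algebra_antisym[OF br, of "br u w" v]
        lie_algebra_antisym[OF br, of "br v w" u] lie_algebra_antisym[OF br, of w u]
      by (simp add: bilinear_rneg[OF lie_algebra_bilinear[OF br]])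
    then have "\<phi> (br (br u v) w - br (br u w) v + br (br v w) u) = 0"
      using lie_algebra_jacobi[OF br, of u v w] linear_0[OF \<phi>(1)] by simp
    then show ?thesis
      by (simp add: \<phi>(2) ce_d2_def ce_d1_def linear_add[OF \<phi>(1)] linear_diff[OF \<phi>(1)])
  qed
  ultimately show "\<alpha> \<in> closed_two_forms br"
    by (simp add: closed_two_forms_def)
qed

text \<open>This is \<open>d \<phi> \<and> \<alpha> = \<phi> \<and> d \<alpha>\<close>, evaluated on the basis. The difference of the two sides is
  \<open>d (\<phi> \<and> \<alpha>)\<close>, and \<open>d\<close> is zero on \<open>3\<close>-forms for a unimodular algebra; in structure constants, the
  terms that do not match directly are multiples of the four traces.\<close>
lemma pairing_exact:
  assumes \<zeta>: "four_vector_basis \<zeta>" and br: "lie_algebra br" and uni: "unimodular br"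
    and \<alpha>: "\<alpha> \<in> two_forms" and \<phi>: "linear \<phi>"
  shows "pairing \<zeta> (ce_d1 br \<phi>) \<alpha> =
     \<phi> (\<zeta> 0) * ce_d2 br \<alpha> (\<zeta> 1) (\<zeta> 2) (\<zeta> 3) - \<phi> (\<zeta> 1) * ce_d2 br \<alpha> (\<zeta> 0) (\<zeta> 2) (\<zeta> 3)
     + \<phi> (\<zeta> 2) * ce_d2 br \<alpha> (\<zeta> 0) (\<zeta> 1) (\<zeta> 3) - \<phi> (\<zeta> 3) * ce_d2 br \<alpha> (\<zeta> 0) (\<zeta> 1) (\<zeta> 2)"
proof -
  define c where "c i j k = dual_coord \<zeta> k (br (\<zeta> i) (\<zeta> j))" for i j k
  have expand: "br (\<zeta> i) (\<zeta> j)
      = c i j 0 *\<^sub>R \<zeta> 0 + c i j 1 *\<^sub>R \<zeta> 1 + c i j 2 *\<^sub>R \<zeta> 2 + c i j 3 *\<^sub>R \<zeta> 3" for i j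
    unfolding c_def by (rule basis_expansion[OF \<zeta>])
  have antisym: "c j i k = - c i j k" for i j k
    unfolding c_def using lie_algebra_antisym[OF br, of "\<zeta> j" "\<zeta> i"]
    by (simp add: linear_neg[OF linear_dual_coord[OF \<zeta>]])
  have diag: "c i i k = 0" for i k
    using antisym[of i i k] by simp
  have "c j 0 0 + c j 1 1 + c j 2 2 + c j 3 3 = 0" for j
    using uni lin_trace_eq[OF \<zeta>, of "br (\<zeta> j)"] lie_algebra_bilinear[OF br]
    by (simp add: unimodular_def bilinear_def lessThan_4 c_def)
  \<comment> \<open>The four trace conditions, solved for one structure constant each so that they can be used as
    rewrite rules.\<close>
  from this[of 0] this[of 1] this[of 2] this[of 3]
  have trace: "c 0 3 3 = - c 0 1 1 - c 0 2 2" "c 1 3 3 = c 0 1 0 - c 1 2 2"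
      "c 2 3 3 = c 0 2 0 + c 1 2 1" "c 2 3 2 = - c 0 3 0 - c 1 3 1"
    using antisym[of 0 1] antisym[of 0 2] antisym[of 0 3] antisym[of 1 2] antisym[of 1 3]
      antisym[of 2 3] diag
    by auto
  note bil = two_form_bilinear[OF \<alpha>]
  have \<alpha>_antisym: "\<alpha> (\<zeta> 1) (\<zeta> 0) = - \<alpha> (\<zeta> 0) (\<zeta> 1)" "\<alpha> (\<zeta> 2) (\<zeta> 0) = - \<alpha> (\<zeta> 0) (\<zeta> 2)"
    "\<alpha> (\<zeta> 3) (\<zeta> 0) = - \<alpha> (\<zeta> 0) (\<zeta> 3)" "\<alpha> (\<zeta> 2) (\<zeta> 1) = - \<alpha> (\<zeta> 1) (\<zeta> 2)"
    "\<alpha> (\<zeta> 3) (\<zeta> 1) = - \<alpha> (\<zeta> 1) (\<zeta> 3)" "\<alpha> (\<zeta> 3) (\<zeta> 2) = - \<alpha> (\<zeta> 2) (\<zeta> 3)"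
    by (rule two_form_antisym[OF \<alpha>])+
  show ?thesis
    by (simp add: pairing_def wedge_def ce_d1_def ce_d2_def expand linear_add[OF \<phi>] linear_scale[OF \<phi>]
        bilinear_ladd[OF bil] bilinear_lmul[OF bil] two_form_diag[OF \<alpha>] \<alpha>_antisym trace
        del: One_nat_def)
      (simp add: algebra_simps)
qed

text \<open>The exterior derivative of a \<open>2\<close>-form is trilinear and alternating, so increasing triples of
  basis vectors determine it.\<close>
lemma closed_if_zero_on_basis:
  assumes \<zeta>: "four_vector_basis \<zeta>" and br: "lie_algebra br" and \<alpha>: "\<alpha> \<in> two_forms"
    and zero: "ce_d2 br \<alpha> (\<zeta> 0) (\<zeta> 1) (\<zeta> 2) = 0" "ce_d2 br \<alpha> (\<zeta> 0) (\<zeta> 1) (\<zeta> 3) = 0"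
      "ce_d2 br \<alpha> (\<zeta> 0) (\<zeta> 2) (\<zeta> 3) = 0" "ce_d2 br \<alpha> (\<zeta> 1) (\<zeta> 2) (\<zeta> 3) = 0"
  shows "\<alpha> \<in> closed_two_forms br"
proof -
  let ?T = "ce_d2 br \<alpha>"
  note bil = two_form_bilinear[OF \<alpha>] lie_algebra_bilinear[OF br]
  have T_linear: "linear (\<lambda>u. ?T u v w)" "linear (\<lambda>v. ?T u v w)" "linear (\<lambda>w. ?T u v w)" for u v w
    unfolding ce_d2_def
    by (intro linearI;
        simp add: bilinear_ladd[OF bil(1)] bilinear_radd[OF bil(1)] bilinear_ladd[OF bil(2)]
          bilinear_radd[OF bil(2)] bilinear_lmul[OF bil(1)] bilinear_rmul[OF bil(1)]
          bilinear_lmul[OF bil(2)] bilinear_rmul[OF bil(2)] algebra_simps)+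
  have br_neg: "\<alpha> (br y x) z = - \<alpha> (br x y) z" for x y z
    using lie_algebra_antisym[OF br, of y x] bilinear_lneg[OF bil(1), of "br x y" z] by simp
  have T_swap: "?T y x z = - ?T x y z" "?T x z y = - ?T x y z" for x y z
    using br_neg[of x y z] br_neg[of y z x] by (simp_all add: ce_d2_def)
  have T_diag: "?T x x z = 0" "?T x z z = 0" "?T x z x = 0" for x z
    using T_swap(1)[of x x z] T_swap(2)[of x z z] T_swap(2)[of x x z] T_swap(1)[of x x z] by auto
  have perm: "?T x z y = 0" "?T y x z = 0" "?T y z x = 0" "?T z x y = 0" "?T z y x = 0"
    if "?T x y z = 0" for x y z
    using that T_swap(1)[of x y z] T_swap(2)[of x y z] T_swap(2)[of y x z] T_swap(1)[of x z y]
      T_swap(2)[of z x y] by simp_all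
  define I where "I = ({0, 1, 2, 3} :: nat set)"
  have "?T (\<zeta> i) (\<zeta> j) (\<zeta> k) = 0" if "i \<in> I" "j \<in> I" "k \<in> I" for i j k
    using that zero perm[OF zero(1)] perm[OF zero(2)] perm[OF zero(3)] perm[OF zero(4)] T_diag
    unfolding I_def by (elim insertE emptyE) (simp_all del: One_nat_def)
  then have "?T (\<zeta> i) (\<zeta> j) = (\<lambda>_. 0)" if "i \<in> I" "j \<in> I" for i j
    using that by (intro linear_eq_on_basis[OF \<zeta> T_linear(3) linear_zero]) (auto simp: I_def)
  then have "(\<lambda>v. ?T (\<zeta> i) v w) = (\<lambda>_. 0)" if "i \<in> I" for i w
    using that by (intro linear_eq_on_basis[OF \<zeta> T_linear(2) linear_zero]) (auto simp: I_def)
  then have "?T (\<zeta> i) v w = 0" if "i \<in> I" for i v w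
    using that by meson
  then have "(\<lambda>u. ?T u v w) = (\<lambda>_. 0)" for v w
    by (intro linear_eq_on_basis[OF \<zeta> T_linear(1) linear_zero]) (auto simp: I_def)
  then show ?thesis
    using \<alpha> by (auto simp: closed_two_forms_def fun_eq_iff)
qed

text \<open>Testing orthogonality of \<open>\<alpha>\<close> against \<open>d \<phi>\<close> for the four dual basis covectors \<open>\<phi>\<close> singles
  out the four components of \<open>d \<alpha>\<close>.\<close>
proposition closed_forms_eq_nperp_exact:
  assumes \<zeta>: "four_vector_basis \<zeta>" and br: "lie_algebra br" and uni: "unimodular br"
  shows "form_coords \<zeta> ` closed_two_forms br = nperp (form_coords \<zeta> ` exact_two_forms br)"
proof -
  have "\<alpha> \<in> closed_two_forms br \<longleftrightarrow> (\<forall>\<phi>. linear \<phi> \<longrightarrow> pairing \<zeta> (ce_d1 br \<phi>) \<alpha> = 0)"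
    if \<alpha>: "\<alpha> \<in> two_forms" for \<alpha>
  proof
    assume "\<alpha> \<in> closed_two_forms br"
    then show "\<forall>\<phi>. linear \<phi> \<longrightarrow> pairing \<zeta> (ce_d1 br \<phi>) \<alpha> = 0"
      using pairing_exact[OF \<zeta> br uni \<alpha>] by (simp add: closed_two_forms_def)
  next
    assume *: "\<forall>\<phi>. linear \<phi> \<longrightarrow> pairing \<zeta> (ce_d1 br \<phi>) \<alpha> = 0"
    have "pairing \<zeta> (ce_d1 br (dual_coord \<zeta> k)) \<alpha> = 0" for k
      using * linear_dual_coord[OF \<zeta>] by blast
    from this[of 0] this[of 1] this[of 2] this[of 3] show "\<alpha> \<in> closed_two_forms br"
      using dual_coord_basis_numerals[OF \<zeta>]
      by (intro closed_if_zero_on_basis[OF \<zeta> br \<alpha>])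
        (simp_all add: pairing_exact[OF \<zeta> br uni \<alpha> linear_dual_coord[OF \<zeta>]])
  qed
  then have closed_iff: "\<alpha> \<in> closed_two_forms br \<longleftrightarrow> form_coords \<zeta> \<alpha> \<in> nperp (form_coords \<zeta> ` exact_two_forms br)"
    if "\<alpha> \<in> two_forms" for \<alpha>
    using that by (auto simp: nperp_def exact_two_forms_def pairing_form_coords)
  show ?thesis
  proof (intro equalityI subsetI)
    fix z assume "z \<in> nperp (form_coords \<zeta> ` exact_two_forms br)"
    moreover obtain \<alpha> where "\<alpha> \<in> two_forms" "z = form_coords \<zeta> \<alpha>"
      using form_coords_surj[OF \<zeta>] by blast
    ultimately show "z \<in> form_coords \<zeta> ` closed_two_forms br"
      using closed_iff by blast
  qed (use closed_iff closed_subset_two_forms in blast)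
qed

section \<open>The invariant b-plus\<close>

text \<open>The graph of \<open>-id\<close> is negative definite of half the dimension, so a positive semidefinite
  subspace meets it trivially.\<close>
lemma dim_semidefinite_le:
  fixes U :: "('e::euclidean_space \<times> 'e) set"
  assumes U: "subspace U" and nonneg: "\<And>u. u \<in> U \<Longrightarrow> 0 \<le> u \<bullet> prod.swap u"
  shows "dim U \<le> DIM('e)"
proof -
  define N where "N = range (\<lambda>x::'e. (x, - x))"
  have lin: "linear (\<lambda>x::'e. (x, - x))"
    by (rule linearI) auto
  have N: "subspace N" "dim N = DIM('e)"
    using linear_subspace_image[OF lin subspace_UNIV] dim_image_inj_on[OF lin subspace_UNIV]
    by (auto simp: N_def inj_on_def)
  have "u = 0" if "u \<in> U" "u \<in> N" for u
  proof -
    obtain x where x: "u = (x, - x)"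
      using \<open>u \<in> N\<close> by (auto simp: N_def)
    then have "x \<bullet> x \<le> 0"
      using nonneg[OF \<open>u \<in> U\<close>] by simp
    then have "x = 0"
      using inner_ge_zero[of x] inner_eq_zero_iff[of x] by linarith
    then show ?thesis
      using x by (simp add: zero_prod_def)
  qed
  then have "U \<inter> N = {0}"
    using subspace_0[OF U] subspace_0[OF N(1)] by auto
  then have "dim {x + y |x y. x \<in> U \<and> y \<in> N} = dim U + DIM('e)"
    using dim_sums_Int[OF U N(1)] N(2) by simp
  moreover have "dim {x + y |x y. x \<in> U \<and> y \<in> N} \<le> DIM('e) + DIM('e)"
    using dim_subset_UNIV[of "{x + y |x y. x \<in> U \<and> y \<in> N}"] by simp
  ultimately show ?thesis
    by simp
qed

lemma quot_subspace_coset_image: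
  assumes B: "subspace B" and V: "subspace V"
  shows "quot_subspace B (coset B ` V)"
  unfolding quot_subspace_def
proof (intro conjI allI impI)
  show "coset B 0 \<in> coset B ` V"
    using subspace_0[OF V] by (rule imageI)
  fix x y assume "coset B x \<in> coset B ` V" "coset B y \<in> coset B ` V"
  then obtain v w where vw: "v \<in> V" "w \<in> V" "x - v \<in> B" "y - w \<in> B"
    using B by (auto simp: coset_eq_iff)
  have "(x + y) - (v + w) \<in> B"
    using subspace_add[OF B vw(3,4)] by (simp add: algebra_simps)
  then show "coset B (x + y) \<in> coset B ` V"
    using subspace_add[OF V vw(1,2)] coset_eq_iff[OF B, of "x + y" "v + w"] by blast
next
  fix r x assume "coset B x \<in> coset B ` V"
  then obtain v where v: "v \<in> V" "x - v \<in> B"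
    using B by (auto simp: coset_eq_iff)
  have "r *\<^sub>R x - r *\<^sub>R v \<in> B"
    using subspace_scale[OF B v(2), of r] by (simp add: scaleR_diff_right)
  then show "coset B (r *\<^sub>R x) \<in> coset B ` V"
    using subspace_scale[OF V v(1)] coset_eq_iff[OF B, of "r *\<^sub>R x" "r *\<^sub>R v"] by blast
qed auto

lemma quot_subspace_preimage: "quot_subspace B W \<Longrightarrow> subspace {x. coset B x \<in> W}"
  by (auto simp: quot_subspace_def subspace_def)

lemma pairing_closed_exact:
  assumes "four_vector_basis \<zeta>" "lie_algebra br" "unimodular br"
    and "\<alpha> \<in> closed_two_forms br" "\<beta> \<in> exact_two_forms br"
  shows "pairing \<zeta> \<beta> \<alpha> = 0"
proof -
  have "form_coords \<zeta> \<alpha> \<in> nperp (form_coords \<zeta> ` exact_two_forms br)"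
    using closed_forms_eq_nperp_exact[OF assms(1-3)] assms(4) by blast
  then show ?thesis
    using assms(5) by (simp add: nperp_def pairing_form_coords)
qed

lemma pairing_add_exact:
  assumes "four_vector_basis \<zeta>" "lie_algebra br" "unimodular br"
    and "\<alpha> \<in> closed_two_forms br" "\<beta> \<in> exact_two_forms br"
  shows "pairing \<zeta> (\<alpha> + \<beta>) (\<alpha> + \<beta>) = pairing \<zeta> \<alpha> \<alpha>"
proof -
  have "pairing \<zeta> \<beta> \<alpha> = 0" "pairing \<zeta> \<beta> \<beta> = 0"
    using pairing_closed_exact[OF assms(1-3)] exact_subset_closed[OF assms(2)] assms(4,5) by blast+
  moreover have "pairing \<zeta> \<alpha> \<beta> = pairing \<zeta> \<beta> \<alpha>"
    unfolding pairing_form_coords by (rule inner_swap_commute)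
  moreover have "pairing \<zeta> (\<alpha> + \<beta>) (\<alpha> + \<beta>)
      = pairing \<zeta> \<alpha> \<alpha> + pairing \<zeta> \<alpha> \<beta> + pairing \<zeta> \<beta> \<alpha> + pairing \<zeta> \<beta> \<beta>"
    unfolding pairing_form_coords linear_add[OF linear_form_coords]
      linear_add[OF linear_swap] inner_add_left inner_add_right by simp
  ultimately show ?thesis
    by simp
qed

text \<open>Lift an independent family in \<open>W\<close> to a subspace \<open>U\<close> of closed forms. The pairing ignores exact
  summands, so \<open>U + B\<close> is positive semidefinite, and its dimension is at most \<open>3\<close>. The sum is direct
  because the family is independent modulo \<open>B\<close>.\<close>
lemma positive_definite_dim_le:
  fixes br :: "'a::real_vector \<Rightarrow> 'a \<Rightarrow> 'a"
  assumes \<zeta>: "four_vector_basis \<zeta>" and br: "lie_algebra br" and uni: "unimodular br"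
    and W: "W \<subseteq> H2 br" "quot_subspace (exact_two_forms br) W" "positive_definite_on br \<zeta> W"
    and S: "finite S" "S \<subseteq> W" "quot_independent (exact_two_forms br) S"
  shows "card S + dim (exact_two_forms br) \<le> 3"
proof -
  let ?B = "exact_two_forms br" and ?Z = "closed_two_forms br" and ?F = "form_coords \<zeta>"
  note B = subspace_exact[of br]
  have BZ: "?B \<subseteq> ?Z"
    by (rule exact_subset_closed[OF br])
  have coset_closed: "C \<subseteq> ?Z" if C: "C \<in> S" for C
  proof -
    obtain z where "z \<in> ?Z" "C = coset ?B z"
      using S(2) W(1) C by (auto simp: H2_def coh_class_def)
    then show ?thesis
      using subspace_add[OF subspace_closed] BZ by (auto simp: coset_def)
  qed
  have S_cosets: "S \<subseteq> range (coset ?B)"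
    using S(2) W(2) by (auto simp: quot_subspace_def)
  define f where "f C = (SOME \<alpha>. \<alpha> \<in> C)" for C :: "('a \<Rightarrow> 'a \<Rightarrow> real) set"
  have f: "f C \<in> C" if C: "C \<in> S" for C
  proof -
    obtain x where "C = coset ?B x"
      using S_cosets C by blast
    then have "x \<in> C"
      using subspace_0[OF B] by (simp add: in_coset_iff)
    then show ?thesis
      unfolding f_def by (rule someI[of "\<lambda>\<alpha>. \<alpha> \<in> C"])
  qed
  note rep = quot_independent_representatives[OF B S(1) S_cosets S(3) f]
  let ?U = "span (f ` S)"
  have UZ: "?U \<subseteq> ?Z"
    using f coset_closed by (intro span_minimal subspace_closed) auto
  have "coset ?B u \<in> W" if "u \<in> ?U" for u
  proof -
    have "f ` S \<subseteq> {x. coset ?B x \<in> W}"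
    proof clarify
      fix C assume "C \<in> S"
      then obtain x where x: "C = coset ?B x"
        using S_cosets by blast
      then have "coset ?B (f C) = C"
        using f[OF \<open>C \<in> S\<close>] by (simp add: in_coset_iff coset_eq_iff[OF B])
      then show "coset ?B (f C) \<in> W"
        using S(2) \<open>C \<in> S\<close> by auto
    qed
    from span_minimal[OF this quot_subspace_preimage[OF W(2)]] show ?thesis
      using that by auto
  qed
  then have positive: "0 \<le> pairing \<zeta> u u" if "u \<in> ?U" for u
  proof (cases "u = 0")
    case True
    then show ?thesis
      by (simp add: pairing_def wedge_def zero_fun_def)
  next
    case False
    then have "u \<notin> ?B"
      using rep(3) that by auto
    then have "coset ?B u \<noteq> coh_class br 0"
      by (simp add: coh_class_def coset_eq_self_iff[OF B])
    moreover have "u \<in> coset ?B u"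
      using subspace_0[OF B] by (simp add: in_coset_iff)
    ultimately show ?thesis
      using W(3) \<open>\<And>u. u \<in> ?U \<Longrightarrow> coset ?B u \<in> W\<close>[OF that]
      by (auto simp: positive_definite_on_def intro: less_imp_le)
  qed
  let ?K = "{x + y |x y. x \<in> ?F ` ?U \<and> y \<in> ?F ` ?B}"
  have sub: "subspace (?F ` ?U)" "subspace (?F ` ?B)"
    by (intro linear_subspace_image linear_form_coords subspace_span B)+
  have "dim ?K \<le> 3"
  proof -
    have "0 \<le> k \<bullet> prod.swap k" if k: "k \<in> ?K" for k
    proof -
      obtain u b where ub: "u \<in> ?U" "b \<in> ?B" "k = ?F u + ?F b"
        using k by blast
      then have "k = ?F (u + b)"
        by (simp add: linear_add[OF linear_form_coords])
      with ub have "k \<bullet> prod.swap k = pairing \<zeta> u u"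
        using pairing_add_exact[OF \<zeta> br uni, of u b] UZ by (auto simp: pairing_form_coords)
      then show ?thesis
        using positive[OF ub(1)] by simp
    qed
    with subspace_sums[OF sub] have "dim ?K \<le> DIM(real \<times> real \<times> real)"
      by (rule dim_semidefinite_le)
    then show ?thesis
      by simp
  qed
  moreover have "?F ` ?U \<inter> ?F ` ?B = {0}"
  proof -
    have "?F ` ?U \<inter> ?F ` ?B = ?F ` (?U \<inter> ?B)"
      using UZ BZ closed_subset_two_forms[of br] by (intro form_coords_image_Int[OF \<zeta>, symmetric]) auto
    then show ?thesis
      by (simp add: rep(3) linear_0[OF linear_form_coords])
  qed
  moreover have "dim (?F ` ?U) = card S" "dim (?F ` ?B) = dim ?B"
    using dim_form_coords_image[OF \<zeta> subspace_span, of "f ` S"] dim_form_coords_image[OF \<zeta> B]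
      UZ BZ closed_subset_two_forms[of br] rep(1,2)
    by (auto simp: dim_eq_card_independent card_image)
  ultimately show ?thesis
    using dim_sums_Int[OF sub] by simp
qed

text \<open>The bound just obtained is attained: intersect the closed forms with the three-dimensional
  positive definite space of self-dual forms, the diagonal \<open>P\<close> in coordinates.\<close>
theorem b_plus_add_dim_exact:
  fixes br :: "'a::real_vector \<Rightarrow> 'a \<Rightarrow> 'a"
  assumes \<zeta>: "four_vector_basis \<zeta>" and br: "lie_algebra br" and uni: "unimodular br"
  shows "b_plus br \<zeta> + dim (exact_two_forms br) = 3"
proof -
  let ?B = "exact_two_forms br" and ?Z = "closed_two_forms br" and ?F = "form_coords \<zeta>"
  note B = subspace_exact[of br]
  define P where "P = range (\<lambda>x :: real \<times> real \<times> real. (x, x))"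
  have lin: "linear (\<lambda>x :: real \<times> real \<times> real. (x, x))"
    by (rule linearI) auto
  have P: "subspace P" "dim P = 3"
    using linear_subspace_image[OF lin subspace_UNIV] dim_image_inj_on[OF lin subspace_UNIV]
    by (auto simp: P_def inj_on_def)
  define V where "V = ?Z \<inter> ?F -` P"
  have V: "subspace V" "V \<subseteq> ?Z" "V \<subseteq> two_forms"
    using closed_subset_two_forms[of br] linear_subspace_vimage[OF linear_form_coords P(1)]
    by (auto simp: V_def intro!: subspace_inter subspace_closed)
  have image_B: "subspace (?F ` ?B)" "dim (?F ` ?B) = dim ?B"
    using B exact_subset_closed[OF br] closed_subset_two_forms[of br]
    by (auto intro!: linear_subspace_image linear_form_coords dim_form_coords_image[OF \<zeta>])
  have "3 \<le> dim V + dim ?B"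
  proof -
    have "?F ` V = nperp (?F ` ?B) \<inter> P"
      by (auto simp: V_def simp flip: closed_forms_eq_nperp_exact[OF \<zeta> br uni])
    then have "dim (nperp (?F ` ?B) \<inter> P) = dim V"
      using dim_form_coords_image[OF \<zeta> V(1,3)] by simp
    then show ?thesis
      using dim_sums_Int[OF subspace_nperp P(1), of "?F ` ?B"] P(2) dim_nperp[OF image_B(1)] image_B(2)
        dim_subset_UNIV[of "{x + y |x y. x \<in> nperp (?F ` ?B) \<and> y \<in> P}"]
      by simp
  qed
  have positive: "0 < pairing \<zeta> v v" if v: "v \<in> V" "v \<noteq> 0" for v
  proof -
    obtain x where x: "?F v = (x, x)"
      using v(1) by (auto simp: V_def P_def)
    have "x \<noteq> 0"
    proof
      assume "x = 0"
      then have "?F v = ?F 0"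
        by (simp add: x linear_0[OF linear_form_coords] zero_prod_def)
      then show False
        using v V(3) two_form_eqI[OF \<zeta>, of v 0] subspace_0[OF subspace_two_forms] by auto
    qed
    then show ?thesis
      by (simp add: pairing_form_coords x)
  qed
  have VB: "V \<inter> ?B = {0}"
  proof -
    have "pairing \<zeta> v v = 0" if "v \<in> V" "v \<in> ?B" for v
      using pairing_closed_exact[OF \<zeta> br uni] V(2) that by blast
    then show ?thesis
      using positive subspace_0[OF V(1)] subspace_0[OF B] by fastforce
  qed
  let ?W = "coset ?B ` V"
  have W: "?W \<subseteq> H2 br" "quot_subspace ?B ?W"
    using V by (auto simp: H2_def coh_class_def quot_subspace_coset_image[OF B])
  have W_pos: "positive_definite_on br \<zeta> ?W"
    unfolding positive_definite_on_def
  proof (intro ballI impI)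
    fix C \<alpha> assume C: "C \<in> ?W" "C \<noteq> coh_class br 0" "\<alpha> \<in> C"
    then obtain v b where vb: "v \<in> V" "C = coset ?B v" "b \<in> ?B" "\<alpha> = v + b"
      by (auto simp: coset_def)
    have "v \<noteq> 0"
      using C(2) vb(2) by (auto simp: coh_class_def)
    then show "0 < pairing \<zeta> \<alpha> \<alpha>"
      using pairing_add_exact[OF \<zeta> br uni, of v b] positive[of v] vb V(2) by auto
  qed
  obtain b where b: "finite b" "(two_forms :: ('a \<Rightarrow> 'a \<Rightarrow> real) set) \<subseteq> span b"
    using two_forms_finitely_spanned[OF \<zeta>] by blast
  have W_dim: "quot_dim ?B ?W = dim V"
    using quot_dim_coset_image[OF B V(1) VB b(1)] V(3) b(2) by simp
  have upper: "quot_dim ?B W \<le> 3 - dim ?B"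
    if "W \<subseteq> H2 br" "quot_subspace ?B W" "positive_definite_on br \<zeta> W" for W
    using positive_definite_dim_le[OF \<zeta> br uni that] by (intro quot_dim_le) fastforce
  have "dim V = 3 - dim ?B"
    using upper[OF W W_pos] W_dim \<open>3 \<le> dim V + dim ?B\<close> by simp
  have "dim ?B \<le> 3"
    using positive_definite_dim_le[OF \<zeta> br uni W W_pos, of "{}"] by (simp add: quot_independent_def)
  have "b_plus br \<zeta> = 3 - dim ?B"
    unfolding b_plus_def
  proof (rule Max_eqI)
    let ?D = "{quot_dim ?B W | W. W \<subseteq> H2 br \<and> quot_subspace ?B W \<and> positive_definite_on br \<zeta> W}"
    show le: "y \<le> 3 - dim ?B" if "y \<in> ?D" for y
      using that upper by blast
    then show "finite ?D"
      using finite_subset[of ?D "{..3 - dim ?B}"] by blast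
    show "3 - dim ?B \<in> ?D"
      using W W_pos W_dim \<open>dim V = 3 - dim ?B\<close> by (intro CollectI exI[of _ ?W]) simp
  qed
  then show ?thesis
    using \<open>dim ?B \<le> 3\<close> by simp
qed

section \<open>Bases adapted to an almost complex structure\<close>

lemma almost_complex_linear: "almost_complex J \<Longrightarrow> linear J"
  and almost_complex_square: "almost_complex J \<Longrightarrow> J (J v) = - v"
  by (auto simp: almost_complex_def)

text \<open>Modulo a \<open>J\<close>-invariant subspace, \<open>J\<close> has no real eigenvector, since \<open>c\<^sup>2 = -1\<close> has no real
  solution. This yields the linear independence of the adapted basis.\<close>
lemma almost_complex_no_eigenvector_modulo:
  assumes J: "almost_complex J" and K: "subspace K" "\<And>k. k \<in> K \<Longrightarrow> J k \<in> K"
    and v: "J v - c *\<^sub>R v \<in> K"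
  shows "v \<in> K"
proof -
  let ?k = "J v - c *\<^sub>R v"
  have "J ?k = - v - c *\<^sub>R J v"
    by (simp add: linear_diff[OF almost_complex_linear[OF J]] linear_scale[OF almost_complex_linear[OF J]]
        almost_complex_square[OF J])
  moreover have "J ?k + c *\<^sub>R ?k \<in> K"
    using K v by (intro subspace_add subspace_scale) auto
  moreover define d where "d = 1 + c * c"
  ultimately have "- d *\<^sub>R v \<in> K"
    by (simp add: algebra_simps)
  then have "- inverse d *\<^sub>R (- d *\<^sub>R v) \<in> K"
    by (rule subspace_scale[OF K(1)])
  moreover have "d \<noteq> 0"
    using sum_power2_gt_zero_iff[of 1 c] by (simp add: d_def power2_eq_square)
  ultimately show ?thesis
    by simp
qed

lemma adapted_basis_exists:
  fixes J :: "'a::real_vector \<Rightarrow> 'a" and \<zeta> :: "nat \<Rightarrow> 'a"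
  assumes \<zeta>: "four_vector_basis \<zeta>" and J: "almost_complex J"
  obtains e where "four_vector_basis e" "J (e 0) = e 1" "J (e 2) = e 3"
proof -
  note linJ = almost_complex_linear[OF J]
  have indep: "independent (\<zeta> ` {..<4})" and card: "card (\<zeta> ` {..<4}) = 4"
    and span: "span (\<zeta> ` {..<4}) = UNIV"
    using \<zeta> by (auto simp: four_vector_basis_def card_image)
  define x where "x = \<zeta> 0"
  have "x \<noteq> 0"
    using indep dependent_zero[of "\<zeta> ` {..<4}"] unfolding x_def by (metis image_eqI lessThan_iff zero_less_numeral)
  define K where "K = span {J x, x}"
  have J_K: "J k \<in> K" if "k \<in> K" for k
  proof -
    have "J ` {J x, x} \<subseteq> K"
      using span_base[of x "{J x, x}"] span_base[of "J x" "{J x, x}"]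
      by (auto simp: K_def almost_complex_square[OF J] span_neg)
    then have "J ` K \<subseteq> K"
      unfolding K_def linear_span_image[OF linJ, symmetric] by (intro span_minimal) auto
    then show ?thesis
      using that by blast
  qed
  have "subspace K"
    by (simp add: K_def)
  have "K \<noteq> UNIV"
  proof
    assume "K = UNIV"
    then have "card (\<zeta> ` {..<4}) \<le> card {J x, x}"
      using independent_span_bound[of "{J x, x}" "\<zeta> ` {..<4}"] indep by (simp add: K_def)
    moreover have "card {J x, x} \<le> 2"
      by (simp add: card_insert_if)
    ultimately show False
      using card by simp
  qed
  then obtain y where y: "y \<notin> K"
    by blast
  have "J x \<notin> span {x}"
  proof
    assume "J x \<in> span {x}"
    then obtain c where "J x - c *\<^sub>R x \<in> {0}"
      by (auto simp: span_singleton)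
    then have "x \<in> {0}"
      by (rule almost_complex_no_eigenvector_modulo[OF J subspace_single_0, rotated])
        (auto simp: linear_0[OF linJ])
    with \<open>x \<noteq> 0\<close> show False
      by simp
  qed
  then have 1: "J x \<noteq> x" "independent {J x, x}"
    using span_base[of x "{x}"] \<open>x \<noteq> 0\<close> independent_insert[of "J x" "{x}"] by auto
  have "y \<notin> {J x, x}"
    using y span_base[of y "{J x, x}"] unfolding K_def by blast
  then have 2: "y \<notin> {J x, x}" "independent {y, J x, x}"
    using y 1 by (simp_all add: independent_insert[of y] K_def)
  have Jy: "J y \<notin> span {y, J x, x}"
  proof
    assume "J y \<in> span {y, J x, x}"
    then obtain c where "J y - c *\<^sub>R y \<in> K"
      unfolding span_breakdown_eq[of "J y" y] K_def by blast
    from almost_complex_no_eigenvector_modulo[OF J \<open>subspace K\<close> _ this] have "y \<in> K"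
      using J_K by blast
    with y show False ..
  qed
  then have 3: "J y \<notin> {y, J x, x}"
    using span_base[of "J y" "{y, J x, x}"] by blast
  then have indep': "independent {J y, y, J x, x}"
    using 2 Jy by (simp add: independent_insert[of "J y"])
  have distinct: "distinct [J y, y, J x, x]"
    using 1 2 3 by simp
  have span': "span {J y, y, J x, x} = UNIV"
  proof (rule ccontr)
    assume "span {J y, y, J x, x} \<noteq> UNIV"
    then obtain z where z: "z \<notin> span {J y, y, J x, x}"
      by blast
    then have "z \<notin> {J y, y, J x, x}"
      using span_base[of z "{J y, y, J x, x}"] by blast
    then have "card (insert z {J y, y, J x, x}) = 5"
      using distinct by (simp add: card_insert_if)
    moreover have "independent (insert z {J y, y, J x, x})"
      using z indep' by (simp add: independent_insert)
    ultimately show False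
      using independent_span_bound[of "\<zeta> ` {..<4}" "insert z {J y, y, J x, x}"] span card by simp
  qed
  define e where "e k = [x, J x, y, J y] ! k" for k
  have e: "e 0 = x" "e 1 = J x" "e 2 = y" "e 3 = J y"
    by (simp_all add: e_def)
  have "e ` {..<4} = {J y, y, J x, x}"
    by (auto simp: lessThan_4 e simp del: One_nat_def)
  moreover have "inj_on e {..<4}"
    using distinct by (auto simp: inj_on_def lessThan_4 e simp del: One_nat_def)
  ultimately have "four_vector_basis e"
    using indep' span' by (simp add: four_vector_basis_def)
  then show ?thesis
    using that e by simp
qed

section \<open>Invariant and anti-invariant forms\<close>

definition Lambda_plus :: "('a::real_vector \<Rightarrow> 'a) \<Rightarrow> ('a \<Rightarrow> 'a \<Rightarrow> real) set" where
  "Lambda_plus J = {\<alpha> \<in> two_forms. \<forall>u v. \<alpha> (J u) (J v) = \<alpha> u v}"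

text \<open>Pulling a form back along \<open>J\<close> sends the coordinates \<open>((x1, x2, x3), (y1, y2, y3))\<close> to
  \<open>((x1, -y2, -y3), (y1, -x2, -x3))\<close>; both eigenspaces can be read off from this.\<close>
lemma J_eigenform_iff_coords:
  assumes e: "four_vector_basis e" "J (e 0) = e 1" "J (e 2) = e 3" and J: "almost_complex J"
    and \<alpha>: "\<alpha> \<in> two_forms" and coords: "form_coords e \<alpha> = ((x1, x2, x3), (y1, y2, y3))"
  shows "(\<forall>u v. \<alpha> (J u) (J v) = s * \<alpha> u v) \<longleftrightarrow>
     ((x1, - y2, - y3), (y1, - x2, - x3)) = s *\<^sub>R ((x1, x2, x3), (y1, y2, y3))"
proof -
  note linJ = almost_complex_linear[OF J] and bil = two_form_bilinear[OF \<alpha>]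
  have J_e: "J (e 1) = - e 0" "J (e 3) = - e 2"
    using almost_complex_square[OF J] e(2,3) by metis+
  let ?\<beta> = "\<lambda>u v. \<alpha> (J u) (J v)"
  have "bilinear ?\<beta>"
    using bil linJ by (simp add: bilinear_def linear_iff)
  then have \<beta>: "?\<beta> \<in> two_forms"
    using two_form_diag[OF \<alpha>] by (simp add: two_forms_def)
  have antisym: "\<alpha> (e 1) (e 0) = - \<alpha> (e 0) (e 1)" "\<alpha> (e 2) (e 1) = - \<alpha> (e 1) (e 2)"
      "\<alpha> (e 3) (e 0) = - \<alpha> (e 0) (e 3)" "\<alpha> (e 2) (e 0) = - \<alpha> (e 0) (e 2)"
      "\<alpha> (e 3) (e 2) = - \<alpha> (e 2) (e 3)"
    by (rule two_form_antisym[OF \<alpha>])+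
  have "form_coords e ?\<beta> = ((x1, - y2, - y3), (y1, - x2, - x3))"
    using coords
    by (auto simp: form_coords_def e(2,3) J_e bilinear_lneg[OF bil] bilinear_rneg[OF bil] antisym
        simp del: One_nat_def)
  moreover have "form_coords e (s *\<^sub>R \<alpha>) = s *\<^sub>R ((x1, x2, x3), (y1, y2, y3))"
    by (simp add: linear_scale[OF linear_form_coords] coords)
  moreover have "?\<beta> = s *\<^sub>R \<alpha> \<longleftrightarrow> form_coords e ?\<beta> = form_coords e (s *\<^sub>R \<alpha>)"
    using two_form_eqI[OF e(1) \<beta> subspace_scale[OF subspace_two_forms \<alpha>]] by metis
  moreover have "?\<beta> = s *\<^sub>R \<alpha> \<longleftrightarrow> (\<forall>u v. \<alpha> (J u) (J v) = s * \<alpha> u v)"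
    by (simp add: fun_eq_iff scaleR_fun_def)
  ultimately show ?thesis
    by simp
qed

lemma Lambda_minus_iff_coords:
  assumes "four_vector_basis e" "J (e 0) = e 1" "J (e 2) = e 3" "almost_complex J"
    and "\<alpha> \<in> two_forms" "form_coords e \<alpha> = ((x1, x2, x3), (y1, y2, y3))"
  shows "\<alpha> \<in> Lambda_minus J \<longleftrightarrow> x1 = 0 \<and> y1 = 0 \<and> y2 = x2 \<and> y3 = x3"
  using J_eigenform_iff_coords[OF assms, of "- 1"] assms(5) by (auto simp: Lambda_minus_def)

lemma Lambda_plus_iff_coords:
  assumes "four_vector_basis e" "J (e 0) = e 1" "J (e 2) = e 3" "almost_complex J"
    and "\<alpha> \<in> two_forms" "form_coords e \<alpha> = ((x1, x2, x3), (y1, y2, y3))"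
  shows "\<alpha> \<in> Lambda_plus J \<longleftrightarrow> y2 = - x2 \<and> y3 = - x3"
  using J_eigenform_iff_coords[OF assms, of 1] assms(5) by (auto simp: Lambda_plus_def)

lemma subspace_Lambda_minus:
  fixes J :: "'a::real_vector \<Rightarrow> 'a"
  shows "subspace (Lambda_minus J)"
proof -
  have "subspace {\<alpha> :: 'a \<Rightarrow> 'a \<Rightarrow> real. \<forall>u v. \<alpha> (J u) (J v) = - \<alpha> u v}"
    by (rule subspaceI) (simp_all add: zero_fun_def plus_fun_def scaleR_fun_def)
  moreover have "Lambda_minus J = two_forms \<inter> {\<alpha>. \<forall>u v. \<alpha> (J u) (J v) = - \<alpha> u v}"
    by (auto simp: Lambda_minus_def)
  ultimately show ?thesis
    by (simp add: subspace_inter subspace_two_forms)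
qed

lemma subspace_Lambda_plus:
  fixes J :: "'a::real_vector \<Rightarrow> 'a"
  shows "subspace (Lambda_plus J)"
proof -
  have "subspace {\<alpha> :: 'a \<Rightarrow> 'a \<Rightarrow> real. \<forall>u v. \<alpha> (J u) (J v) = \<alpha> u v}"
    by (rule subspaceI) (simp_all add: zero_fun_def plus_fun_def scaleR_fun_def)
  moreover have "Lambda_plus J = two_forms \<inter> {\<alpha>. \<forall>u v. \<alpha> (J u) (J v) = \<alpha> u v}"
    by (auto simp: Lambda_plus_def)
  ultimately show ?thesis
    by (simp add: subspace_inter subspace_two_forms)
qed

lemma Lambda_minus_subset: "Lambda_minus J \<subseteq> two_forms"
  and Lambda_plus_subset: "Lambda_plus J \<subseteq> two_forms"
  by (auto simp: Lambda_minus_def Lambda_plus_def)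

lemma form_coords_Lambda_minus:
  assumes "four_vector_basis e" "J (e 0) = e 1" "J (e 2) = e 3" "almost_complex J"
  shows "form_coords e ` Lambda_minus J = range (\<lambda>z. ((0, z), (0, z)))" (is "?l = ?r")
proof (intro equalityI subsetI)
  fix p assume "p \<in> ?l"
  then obtain \<alpha> where \<alpha>: "\<alpha> \<in> Lambda_minus J" "p = form_coords e \<alpha>"
    by blast
  obtain x1 x2 x3 y1 y2 y3 where p: "p = ((x1, x2, x3), (y1, y2, y3))"
    by (metis prod.collapse)
  have "\<alpha> \<in> two_forms"
    using \<alpha>(1) Lambda_minus_subset by blast
  then have "p = (\<lambda>z. ((0, z), (0, z))) (x2, x3)"
    using Lambda_minus_iff_coords[OF assms, of \<alpha> x1 x2 x3 y1 y2 y3] \<alpha> p by auto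
  then show "p \<in> ?r"
    by (rule range_eqI)
next
  fix p assume "p \<in> ?r"
  then obtain a b where p: "p = ((0, a, b), (0, a, b))"
    by auto
  obtain \<alpha> where "\<alpha> \<in> two_forms" "p = form_coords e \<alpha>"
    using form_coords_surj[OF assms(1)] by blast
  moreover from this have "\<alpha> \<in> Lambda_minus J"
    using Lambda_minus_iff_coords[OF assms, of \<alpha> 0 a b 0 a b] p by simp
  ultimately show "p \<in> ?l"
    by blast
qed

lemma form_coords_Lambda_plus:
  assumes "four_vector_basis e" "J (e 0) = e 1" "J (e 2) = e 3" "almost_complex J"
  shows "form_coords e ` Lambda_plus J = nperp (form_coords e ` Lambda_minus J)"
proof -
  have iff: "\<alpha> \<in> Lambda_plus J \<longleftrightarrow> form_coords e \<alpha> \<in> nperp (form_coords e ` Lambda_minus J)"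
    if \<alpha>: "\<alpha> \<in> two_forms" for \<alpha>
  proof -
    obtain x1 x2 x3 y1 y2 y3 where p: "form_coords e \<alpha> = ((x1, x2, x3), (y1, y2, y3))"
      by (metis prod.collapse)
    have "form_coords e \<alpha> \<in> nperp (form_coords e ` Lambda_minus J)
        \<longleftrightarrow> (\<forall>a b. a * y2 + b * y3 + (a * x2 + b * x3) = 0)"
      unfolding form_coords_Lambda_minus[OF assms] p by (auto simp: nperp_def)
    also have "\<dots> \<longleftrightarrow> y2 = - x2 \<and> y3 = - x3"
    proof
      assume "\<forall>a b. a * y2 + b * y3 + (a * x2 + b * x3) = 0"
      from this[rule_format, of 1 0] this[rule_format, of 0 1] show "y2 = - x2 \<and> y3 = - x3"
        by simp
    qed (simp add: algebra_simps)
    finally show ?thesis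
      using Lambda_plus_iff_coords[OF assms \<alpha> p] by simp
  qed
  show ?thesis
  proof (intro equalityI subsetI)
    fix z assume z: "z \<in> nperp (form_coords e ` Lambda_minus J)"
    obtain \<alpha> where \<alpha>: "\<alpha> \<in> two_forms" "z = form_coords e \<alpha>"
      using form_coords_surj[OF assms(1)] by blast
    then have "\<alpha> \<in> Lambda_plus J"
      using iff z by simp
    then show "z \<in> form_coords e ` Lambda_plus J"
      using \<alpha>(2) by blast
  next
    fix z assume "z \<in> form_coords e ` Lambda_plus J"
    then obtain \<alpha> where "\<alpha> \<in> Lambda_plus J" "z = form_coords e \<alpha>"
      by blast
    then show "z \<in> nperp (form_coords e ` Lambda_minus J)"
      using iff Lambda_plus_subset by blast
  qed
qed

lemma dim_Lambda_minus:
  assumes "four_vector_basis e" "J (e 0) = e 1" "J (e 2) = e 3" "almost_complex J"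
  shows "dim (form_coords e ` Lambda_minus J) = 2"
proof -
  have lin: "linear (\<lambda>z :: real \<times> real. ((0 :: real, z), (0 :: real, z)))"
    by (rule linearI) auto
  show ?thesis
    unfolding form_coords_Lambda_minus[OF assms]
    by (subst dim_image_inj_on[OF lin subspace_UNIV]) (auto simp: inj_on_def)
qed

text \<open>The pairing is definite on anti-invariant forms: with equal halves of the coordinate vector
  it is twice a sum of squares.\<close>
lemma anti_invariant_null_eq_0:
  assumes "four_vector_basis e" "J (e 0) = e 1" "J (e 2) = e 3" "almost_complex J"
    and \<alpha>: "\<alpha> \<in> Lambda_minus J" "pairing e \<alpha> \<alpha> = 0"
  shows "\<alpha> = 0"
proof -
  have "form_coords e \<alpha> \<in> range (\<lambda>z. ((0, z), (0, z)))"
    using \<alpha>(1) unfolding form_coords_Lambda_minus[OF assms(1-4), symmetric] by (rule imageI)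
  then obtain a b where ab: "form_coords e \<alpha> = ((0, a, b), (0, a, b))"
    by auto
  have "a * a + b * b + (a * a + b * b) = 0"
    using \<alpha>(2) by (simp add: pairing_form_coords ab)
  then have "a\<^sup>2 + b\<^sup>2 = 0"
    unfolding power2_eq_square by linarith
  then have "form_coords e \<alpha> = form_coords e 0"
    by (simp add: ab linear_0[OF linear_form_coords] zero_prod_def sum_power2_eq_zero_iff)
  moreover have "\<alpha> \<in> two_forms"
    using \<alpha>(1) Lambda_minus_subset by blast
  ultimately show ?thesis
    using two_form_eqI[OF assms(1) _ subspace_0[OF subspace_two_forms]] by blast
qed

section \<open>Taming and anti-invariant closed forms\<close>

text \<open>The ambient space of real functions of two vectors is infinite-dimensional, so these facts are
  transported from the coordinate space.\<close>
lemma two_forms_dim_mono: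
  fixes V W :: "('a::real_vector \<Rightarrow> 'a \<Rightarrow> real) set" and \<zeta> :: "nat \<Rightarrow> 'a"
  assumes \<zeta>: "four_vector_basis \<zeta>" and VW: "subspace V" "subspace W" "V \<subseteq> W" "W \<subseteq> two_forms"
  shows "dim V \<le> dim W" "dim V = dim W \<Longrightarrow> V = W"
proof -
  let ?F = "form_coords \<zeta>"
  have dims: "dim (?F ` V) = dim V" "dim (?F ` W) = dim W"
    using VW by (auto intro!: dim_form_coords_image[OF \<zeta>])
  have "?F ` V \<subseteq> ?F ` W"
    using VW(3) by (rule image_mono)
  then show "dim V \<le> dim W"
    using dim_subset[of "?F ` V" "?F ` W"] dims by simp
  assume "dim V = dim W"
  then have "?F ` V = ?F ` W"
    using subspace_dim_equal[of "?F ` V" "?F ` W"] dims \<open>?F ` V \<subseteq> ?F ` W\<close>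
    by (simp add: linear_subspace_image linear_form_coords VW)
  then show "V = W"
    using inj_on_image_eq_iff[OF inj_on_form_coords[OF \<zeta>], of V W] VW(3,4) by blast
qed

lemma dim_eq_0_iff_trivial:
  fixes V :: "('a::real_vector \<Rightarrow> 'a \<Rightarrow> real) set" and \<zeta> :: "nat \<Rightarrow> 'a"
  assumes "four_vector_basis \<zeta>" "subspace V" "V \<subseteq> two_forms"
  shows "dim V = 0 \<longleftrightarrow> V = {0}"
proof
  assume "dim V = 0"
  then show "V = {0}"
    using two_forms_dim_mono(2)[OF assms(1) subspace_single_0 assms(2) _ assms(3)]
      subspace_0[OF assms(2)] dim_span[of "{} :: ('a \<Rightarrow> 'a \<Rightarrow> real) set"]
    by (simp add: dim_eq_card_independent independent_empty)
next
  assume "V = {0}"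
  then show "dim V = 0"
    using dim_span[of "{} :: ('a \<Rightarrow> 'a \<Rightarrow> real) set"] by (simp add: dim_eq_card_independent independent_empty)
qed

text \<open>In coordinates, closed anti-invariant forms are the orthogonal complement of
  \<open>B + \<Lambda>\<^sup>+\<close>, a space of dimension \<open>dim B + 4 - dim (B \<inter> \<Lambda>\<^sup>+)\<close> inside one of dimension \<open>6\<close>.\<close>
proposition dim_closed_anti_invariant:
  assumes e: "four_vector_basis e" "J (e 0) = e 1" "J (e 2) = e 3" and J: "almost_complex J"
    and br: "lie_algebra br" and uni: "unimodular br"
  shows "dim (closed_two_forms br \<inter> Lambda_minus J) + dim (exact_two_forms br)
       = 2 + dim (exact_two_forms br \<inter> Lambda_plus J)"
proof -
  let ?B = "exact_two_forms br" and ?Z = "closed_two_forms br" and ?F = "form_coords e"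
  let ?E = "?F ` ?B" and ?M = "?F ` Lambda_plus J" and ?L = "?F ` Lambda_minus J"
  have B2: "?B \<subseteq> two_forms"
    using exact_subset_closed[OF br] closed_subset_two_forms by blast
  have sub: "subspace ?E" "subspace ?M" "subspace ?L"
    by (intro linear_subspace_image linear_form_coords subspace_exact subspace_Lambda_plus
        subspace_Lambda_minus)+
  have L: "dim ?L = 2" and M: "?M = nperp ?L"
    using dim_Lambda_minus[OF e J] form_coords_Lambda_plus[OF e J] by simp_all
  have dim_M: "dim ?M = 4"
    using dim_nperp[OF sub(3)] L M by simp
  have L_perp: "?L = nperp ?M"
    using nperp_nperp[OF sub(3)] M by simp
  have Z: "?F ` ?Z = nperp ?E"
    by (rule closed_forms_eq_nperp_exact[OF e(1) br uni])
  let ?S = "{x + y |x y. x \<in> ?E \<and> y \<in> ?M}"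
  have "?F ` (?Z \<inter> Lambda_minus J) = nperp ?S"
    using form_coords_image_Int[OF e(1) closed_subset_two_forms Lambda_minus_subset, of br J]
      nperp_Int[OF sub(1,2)] Z L_perp by simp
  moreover have "dim (?F ` (?Z \<inter> Lambda_minus J)) = dim (?Z \<inter> Lambda_minus J)"
    using Lambda_minus_subset[of J]
    by (intro dim_form_coords_image[OF e(1)] subspace_inter subspace_closed subspace_Lambda_minus) auto
  ultimately have "dim (?Z \<inter> Lambda_minus J) = dim (nperp ?S)"
    by metis
  moreover have "dim (nperp ?S) + dim ?S = 6"
    using dim_nperp[OF subspace_sums[OF sub(1,2)]] by simp
  moreover have "dim ?S + dim (?E \<inter> ?M) = dim ?B + 4"
    using dim_sums_Int[OF sub(1,2)] dim_M dim_form_coords_image[OF e(1) subspace_exact B2] by simp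
  moreover have "dim (?E \<inter> ?M) = dim (?B \<inter> Lambda_plus J)"
    using form_coords_image_Int[OF e(1) B2 Lambda_plus_subset, of J]
      dim_form_coords_image[OF e(1), of "?B \<inter> Lambda_plus J"] Lambda_plus_subset[of J]
    by (auto simp: subspace_inter subspace_exact subspace_Lambda_plus)
  ultimately show "dim (?Z \<inter> Lambda_minus J) + dim ?B = 2 + dim (?B \<inter> Lambda_plus J)"
    by simp
qed

text \<open>The orthogonal complement of \<open>Z + \<Lambda>\<^sup>-\<close> is \<open>B \<inter> \<Lambda>\<^sup>+\<close>.\<close>
lemma closed_plus_anti_invariant:
  assumes e: "four_vector_basis e" "J (e 0) = e 1" "J (e 2) = e 3" and J: "almost_complex J"
    and br: "lie_algebra br" and uni: "unimodular br"
    and trivial: "exact_two_forms br \<inter> Lambda_plus J = {0}" and \<omega>: "\<omega> \<in> two_forms"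
  obtains \<alpha> \<mu> where "\<alpha> \<in> closed_two_forms br" "\<mu> \<in> Lambda_minus J" "\<omega> = \<alpha> + \<mu>"
proof -
  let ?B = "exact_two_forms br" and ?Z = "closed_two_forms br" and ?F = "form_coords e"
  let ?E = "?F ` ?B" and ?M = "?F ` Lambda_plus J" and ?L = "?F ` Lambda_minus J"
  have B2: "?B \<subseteq> two_forms"
    using exact_subset_closed[OF br] closed_subset_two_forms by blast
  have sub: "subspace ?E" "subspace ?L"
    by (intro linear_subspace_image linear_form_coords subspace_exact subspace_Lambda_minus)+
  have M: "?M = nperp ?L" and Z: "?F ` ?Z = nperp ?E"
    by (rule form_coords_Lambda_plus[OF e J] closed_forms_eq_nperp_exact[OF e(1) br uni])+
  let ?T = "{x + y |x y. x \<in> nperp ?E \<and> y \<in> ?L}"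
  have "?E \<inter> ?M = {0}"
    using form_coords_image_Int[OF e(1) B2 Lambda_plus_subset, of J] trivial
    by (simp add: linear_0[OF linear_form_coords])
  then have "nperp ?T = {0}"
    using nperp_Int[OF subspace_nperp sub(2), of ?E] M nperp_nperp[OF sub(1)] by simp
  then have "?T = nperp {0}"
    using nperp_nperp[OF subspace_sums[OF subspace_nperp sub(2)], of ?E] by simp
  then have "?T = UNIV"
    by (simp add: nperp_def)
  then have "?F \<omega> \<in> ?T"
    by simp
  then obtain \<alpha> \<mu> where \<alpha>\<mu>: "\<alpha> \<in> ?Z" "\<mu> \<in> Lambda_minus J" "?F \<omega> = ?F \<alpha> + ?F \<mu>"
    unfolding Z[symmetric] by blast
  have "\<alpha> + \<mu> \<in> two_forms"
    using \<alpha>\<mu>(1,2) closed_subset_two_forms Lambda_minus_subset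
    by (intro subspace_add[OF subspace_two_forms]) auto
  moreover have "?F \<omega> = ?F (\<alpha> + \<mu>)"
    using \<alpha>\<mu>(3) by (simp add: linear_add[OF linear_form_coords])
  ultimately have "\<omega> = \<alpha> + \<mu>"
    using two_form_eqI[OF e(1) \<omega>] by blast
  then show ?thesis
    using that \<alpha>\<mu>(1,2) by blast
qed

lemma h_minus_eq_dim:
  fixes br :: "'a::real_vector \<Rightarrow> 'a \<Rightarrow> 'a"
  assumes e: "four_vector_basis e" "J (e 0) = e 1" "J (e 2) = e 3" and J: "almost_complex J"
    and br: "lie_algebra br" and uni: "unimodular br"
  shows "h_minus br J = dim (closed_two_forms br \<inter> Lambda_minus J)"
proof -
  let ?V = "closed_two_forms br \<inter> Lambda_minus J"
  obtain b where b: "finite b" "(two_forms :: ('a \<Rightarrow> 'a \<Rightarrow> real) set) \<subseteq> span b"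
    using two_forms_finitely_spanned[OF e(1)] by blast
  have V: "subspace ?V" "?V \<subseteq> span b"
    using b(2) Lambda_minus_subset by (auto simp: subspace_inter subspace_closed subspace_Lambda_minus)
  have "\<alpha> = 0" if "\<alpha> \<in> ?V" "\<alpha> \<in> exact_two_forms br" for \<alpha>
    using anti_invariant_null_eq_0[OF e J, of \<alpha>] pairing_closed_exact[OF e(1) br uni, of \<alpha> \<alpha>] that by blast
  then have "?V \<inter> exact_two_forms br = {0}"
    using subspace_0[OF V(1)] subspace_0[OF subspace_exact, of br] by auto
  from quot_dim_coset_image[OF subspace_exact V(1) this b(1) V(2)] show ?thesis
    by (simp add: h_minus_def H_minus_def coh_class_def[abs_def])
qed

text \<open>The reverse Cauchy--Schwarz phenomenon in Lorentzian signature, for the quadratic form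
  \<open>x y - u\<^sup>2 - v\<^sup>2\<close>: a null vector orthogonal to a timelike vector is zero. The timelike vector is
  \<open>(p, q, c / 2, a / 2)\<close>.\<close>
lemma timelike_null_orthogonal:
  fixes p q a c x y u v :: real
  assumes "0 < p" "a\<^sup>2 + c\<^sup>2 < 4 * p * q" "x * y = u\<^sup>2 + v\<^sup>2" "x * q + y * p = u * c + v * a"
  shows "x = 0" "y = 0" "u = 0" "v = 0"
proof -
  have "0 \<le> (x * q - y * p)\<^sup>2" "0 \<le> (u * a - v * c)\<^sup>2"
    by simp_all
  moreover have "(x * q - y * p)\<^sup>2 = (u * c + v * a)\<^sup>2 - 4 * p * q * (u\<^sup>2 + v\<^sup>2)"
    unfolding assms(4)[symmetric] assms(3)[symmetric] by (simp add: power2_eq_square algebra_simps)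
  moreover have "(u * a - v * c)\<^sup>2 = (u\<^sup>2 + v\<^sup>2) * (a\<^sup>2 + c\<^sup>2) - (u * c + v * a)\<^sup>2"
    by (simp add: power2_eq_square algebra_simps)
  ultimately have "4 * p * q * (u\<^sup>2 + v\<^sup>2) \<le> (u\<^sup>2 + v\<^sup>2) * (a\<^sup>2 + c\<^sup>2)"
    by linarith
  then have "(u\<^sup>2 + v\<^sup>2) * (4 * p * q - (a\<^sup>2 + c\<^sup>2)) \<le> 0"
    by (simp add: algebra_simps)
  then have "u\<^sup>2 + v\<^sup>2 \<le> 0"
    using assms(2) by (simp add: mult_le_0_iff)
  then show uv: "u = 0" "v = 0"
    by (simp_all add: sum_power2_le_zero_iff)
  have "0 < 4 * p * q"
    using assms(2) by (smt (verit) zero_le_power2)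
  then have "0 < q"
    using assms(1) by (simp add: zero_less_mult_iff)
  then show "x = 0" "y = 0"
    using assms uv by auto
qed

text \<open>In one direction, evaluating a taming form \<open>\<phi>\<close> on a single well-chosen vector shows that its
  invariant part is timelike, and \<open>timelike_null_orthogonal\<close> applies to an invariant exact form,
  which is null and orthogonal to \<open>\<phi>\<close>. In the other direction, the form \<open>\<omega>\<close> with
  \<open>\<omega>(v, J v) = |v|\<^sup>2\<close> in the adapted basis differs from a closed form by an anti-invariant one,
  and anti-invariant forms vanish on all pairs \<open>(v, J v)\<close>.\<close>
proposition tamed_iff_no_invariant_exact_form:
  assumes e: "four_vector_basis e" "J (e 0) = e 1" "J (e 2) = e 3" and J: "almost_complex J"
    and br: "lie_algebra br" and uni: "unimodular br"
  shows "tamed br J \<longleftrightarrow> exact_two_forms br \<inter> Lambda_plus J = {0}"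
proof
  note linJ = almost_complex_linear[OF J]
  have J_e: "J (e 1) = - e 0" "J (e 3) = - e 2"
    using almost_complex_square[OF J] e(2,3) by metis+
  {
    assume "tamed br J"
    then obtain \<phi> where \<phi>: "\<phi> \<in> closed_two_forms br" and pos: "\<And>v. v \<noteq> 0 \<Longrightarrow> 0 < \<phi> v (J v)"
      by (auto simp: tamed_def)
    have \<phi>2: "\<phi> \<in> two_forms"
      using \<phi> closed_subset_two_forms by blast
    note bil = two_form_bilinear[OF \<phi>2]
    obtain p1 p2 p3 q1 q2 q3 where pq: "form_coords e \<phi> = ((p1, p2, p3), (q1, q2, q3))"
      by (metis prod.collapse)
    have coords: "\<phi> (e 0) (e 1) = p1" "\<phi> (e 0) (e 2) = p2" "\<phi> (e 0) (e 3) = p3"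
      "\<phi> (e 2) (e 3) = q1" "\<phi> (e 1) (e 3) = - q2" "\<phi> (e 1) (e 2) = q3"
      using pq by (auto simp: form_coords_def simp del: One_nat_def)
    have antisym: "\<phi> (e 1) (e 0) = - \<phi> (e 0) (e 1)" "\<phi> (e 2) (e 1) = - \<phi> (e 1) (e 2)"
      "\<phi> (e 2) (e 0) = - \<phi> (e 0) (e 2)"
      by (rule two_form_antisym[OF \<phi>2])+
    have "e 0 \<noteq> 0"
      using linear_0[OF linear_dual_coord[OF e(1)], of 0] dual_coord_basis_numerals[OF e(1)] by auto
    then have "0 < p1"
      using pos[of "e 0"] coords e(2) by simp
    \<comment> \<open>For \<open>v = s e\<^sub>0 + t e\<^sub>1 + r e\<^sub>2\<close>, \<open>\<phi>(v, J v)\<close> equals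
      \<open>(s\<^sup>2 + t\<^sup>2) p1 + r\<^sup>2 q1 + r (s a + t c)\<close>. With \<open>r = 2 p1\<close> the choice \<open>s = -a\<close>, \<open>t = -c\<close>
      minimises this, and the minimum is \<open>p1\<close> times the discriminant.\<close>
    define a c where "a = p3 - q3" and "c = p2 - q2"
    define v where "v = - a *\<^sub>R e 0 + - c *\<^sub>R e 1 + (2 * p1) *\<^sub>R e 2"
    have "dual_coord e 2 v = 2 * p1"
      unfolding v_def linear_add[OF linear_dual_coord[OF e(1)]] linear_scale[OF linear_dual_coord[OF e(1)]]
      using dual_coord_basis_numerals[OF e(1)] by simp
    then have "v \<noteq> 0"
      using \<open>0 < p1\<close> linear_0[OF linear_dual_coord[OF e(1)], of 2] by auto
    then have "0 < \<phi> v (J v)"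
      by (rule pos)
    also have "\<phi> v (J v) = p1 * (4 * p1 * q1 - (a\<^sup>2 + c\<^sup>2))"
      unfolding v_def linear_add[OF linJ] linear_scale[OF linJ] e(2,3) J_e
      unfolding bilinear_ladd[OF bil] bilinear_radd[OF bil] bilinear_lmul[OF bil] bilinear_rmul[OF bil]
        bilinear_rneg[OF bil] antisym two_form_diag[OF \<phi>2] coords
      by (simp add: a_def c_def power2_eq_square algebra_simps)
    finally have timelike: "a\<^sup>2 + c\<^sup>2 < 4 * p1 * q1"
      using \<open>0 < p1\<close> by (simp add: zero_less_mult_iff)
    have "\<beta> = 0" if \<beta>: "\<beta> \<in> exact_two_forms br" "\<beta> \<in> Lambda_plus J" for \<beta>
    proof -
      have \<beta>2: "\<beta> \<in> two_forms"
        using \<beta>(2) Lambda_plus_subset by blast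
      obtain x1 x2 x3 y1 y2 y3 where xy: "form_coords e \<beta> = ((x1, x2, x3), (y1, y2, y3))"
        by (metis prod.collapse)
      then have y: "y2 = - x2" "y3 = - x3"
        using Lambda_plus_iff_coords[OF e J \<beta>2 xy] \<beta>(2) by auto
      have "pairing e \<beta> \<beta> = 0" "pairing e \<beta> \<phi> = 0"
        using pairing_closed_exact[OF e(1) br uni _ \<beta>(1)] exact_subset_closed[OF br] \<beta>(1) \<phi> by blast+
      then have "x1 * y1 = x2\<^sup>2 + x3\<^sup>2" "x1 * q1 + y1 * p1 = x2 * c + x3 * a"
        by (simp_all add: pairing_form_coords xy pq y a_def c_def power2_eq_square algebra_simps)
      from timelike_null_orthogonal[OF \<open>0 < p1\<close> timelike this]
      have "form_coords e \<beta> = form_coords e 0"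
        by (simp add: xy y linear_0[OF linear_form_coords] zero_prod_def)
      then show ?thesis
        using two_form_eqI[OF e(1) \<beta>2 subspace_0[OF subspace_two_forms]] by blast
    qed
    then show "exact_two_forms br \<inter> Lambda_plus J = {0}"
      using subspace_0[OF subspace_exact, of br] subspace_0[OF subspace_Lambda_plus, of J] by auto
  next
    assume trivial: "exact_two_forms br \<inter> Lambda_plus J = {0}"
    let ?d = "dual_coord e"
    define \<omega> where "\<omega> = wedge_covectors (?d 0) (?d 1) + wedge_covectors (?d 2) (?d 3)"
    have "\<omega> \<in> two_forms"
      unfolding \<omega>_def
      by (intro subspace_add[OF subspace_two_forms] wedge_covectors_two_form linear_dual_coord e(1))
    then obtain \<alpha> \<mu> where \<alpha>\<mu>: "\<alpha> \<in> closed_two_forms br" "\<mu> \<in> Lambda_minus J" "\<omega> = \<alpha> + \<mu>"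
      by (rule closed_plus_anti_invariant[OF e J br uni trivial])
    have "0 < \<alpha> v (J v)" if "v \<noteq> 0" for v
    proof -
      have \<mu>2: "\<mu> \<in> two_forms"
        using \<alpha>\<mu>(2) Lambda_minus_subset by blast
      have "\<mu> (J v) (J (J v)) = - \<mu> v (J v)"
        using \<alpha>\<mu>(2) by (simp add: Lambda_minus_def)
      then have "\<mu> v (J v) = 0"
        using two_form_antisym[OF \<mu>2, of "J v" v]
        by (simp add: almost_complex_square[OF J] bilinear_rneg[OF two_form_bilinear[OF \<mu>2]])
      then have "\<alpha> v (J v) = \<omega> v (J v)"
        by (simp add: \<alpha>\<mu>(3) plus_fun_def)
      have Jv: "J v = ?d 0 v *\<^sub>R e 1 - ?d 1 v *\<^sub>R e 0 + ?d 2 v *\<^sub>R e 3 - ?d 3 v *\<^sub>R e 2"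
      proof -
        have "J v = J (?d 0 v *\<^sub>R e 0 + ?d 1 v *\<^sub>R e 1 + ?d 2 v *\<^sub>R e 2 + ?d 3 v *\<^sub>R e 3)"
          using basis_expansion[OF e(1), of v] by simp
        then show ?thesis
          unfolding linear_add[OF linJ] linear_scale[OF linJ] e(2,3) J_e by simp
      qed
      have dJ: "?d 0 (J v) = - ?d 1 v" "?d 1 (J v) = ?d 0 v" "?d 2 (J v) = - ?d 3 v" "?d 3 (J v) = ?d 2 v"
        unfolding Jv linear_add[OF linear_dual_coord[OF e(1)]] linear_diff[OF linear_dual_coord[OF e(1)]]
          linear_scale[OF linear_dual_coord[OF e(1)]]
        using dual_coord_basis_numerals[OF e(1)] by simp_all
      have \<omega>_sum: "\<omega> v (J v) = (?d 0 v)\<^sup>2 + (?d 1 v)\<^sup>2 + (?d 2 v)\<^sup>2 + (?d 3 v)\<^sup>2"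
        by (simp add: \<omega>_def plus_fun_def wedge_covectors_def dJ power2_eq_square del: One_nat_def)
      have "\<omega> v (J v) \<noteq> 0"
      proof
        assume "\<omega> v (J v) = 0"
        then have "(?d 0 v)\<^sup>2 = 0 \<and> (?d 1 v)\<^sup>2 = 0 \<and> (?d 2 v)\<^sup>2 = 0 \<and> (?d 3 v)\<^sup>2 = 0"
          using zero_le_power2[of "?d 0 v"] zero_le_power2[of "?d 1 v"] zero_le_power2[of "?d 2 v"]
            zero_le_power2[of "?d 3 v"] unfolding \<omega>_sum by linarith
        then have "v = 0"
          using basis_expansion[OF e(1), of v] by simp
        with that show False ..
      qed
      then show ?thesis
        using \<omega>_sum \<open>\<alpha> v (J v) = \<omega> v (J v)\<close> by (simp add: less_le)
    qed
    then show "tamed br J"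
      using \<alpha>\<mu>(1) by (auto simp: tamed_def)
  }
qed

section \<open>Integrability\<close>

text \<open>If all forms \<open>d \<phi>\<close> are invariant, then so is the bracket itself, and the four terms of the
  integrability condition cancel in pairs.\<close>
lemma integrable_if_exact_invariant:
  fixes br :: "'a::real_vector \<Rightarrow> 'a \<Rightarrow> 'a" and \<zeta> :: "nat \<Rightarrow> 'a"
  assumes \<zeta>: "four_vector_basis \<zeta>" and J: "almost_complex J" and br: "lie_algebra br"
    and inv: "exact_two_forms br \<subseteq> Lambda_plus J"
  shows "integrable_acs br J"
proof -
  have br_JJ: "br (J u) (J v) = br u v" for u v
  proof -
    have "dual_coord \<zeta> k (br (J u) (J v)) = dual_coord \<zeta> k (br u v)" for k
    proof -
      have "ce_d1 br (dual_coord \<zeta> k) \<in> Lambda_plus J"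
        using inv linear_dual_coord[OF \<zeta>, of k] by (auto simp: exact_two_forms_def)
      then show ?thesis
        by (simp add: Lambda_plus_def ce_d1_def)
    qed
    then show ?thesis
      using basis_expansion[OF \<zeta>, of "br (J u) (J v)"] basis_expansion[OF \<zeta>, of "br u v"] by simp
  qed
  have "br (J u) v + br u (J v) = 0" for u v
    using br_JJ[of u "J v"]
    by (simp add: almost_complex_square[OF J] bilinear_rneg[OF lie_algebra_bilinear[OF br]]
        neg_eq_iff_add_eq_0)
  then have "J (br (J u) v) + J (br u (J v)) = 0" for u v
    using linear_add[OF almost_complex_linear[OF J]] linear_0[OF almost_complex_linear[OF J]] by metis
  then show ?thesis
    by (simp add: integrable_acs_def br_JJ algebra_simps)
qed

text \<open>If \<open>\<beta>\<close> spans the exact forms, then \<open>[u, v] = \<beta>(u, v) w\<close> for a vector \<open>w \<noteq> 0\<close>. The integrability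
  condition becomes a linear relation between \<open>w\<close> and \<open>J w\<close>, which are independent.\<close>
lemma exact_invariant_if_integrable:
  fixes br :: "'a::real_vector \<Rightarrow> 'a \<Rightarrow> 'a" and \<zeta> :: "nat \<Rightarrow> 'a"
  assumes \<zeta>: "four_vector_basis \<zeta>" and J: "almost_complex J" and br: "lie_algebra br"
    and dim: "dim (exact_two_forms br) = 1" and int: "integrable_acs br J"
  shows "exact_two_forms br \<subseteq> Lambda_plus J"
proof -
  note linJ = almost_complex_linear[OF J]
  obtain b where b: "b \<subseteq> exact_two_forms br" "independent b" "exact_two_forms br \<subseteq> span b" "card b = 1"
    using basis_exists[of "exact_two_forms br"] dim by metis
  then obtain \<beta> where "b = {\<beta>}"
    by (metis card_1_singletonE)
  have multiple: "\<exists>t. \<alpha> = t *\<^sub>R \<beta>" if "\<alpha> \<in> exact_two_forms br" for \<alpha>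
    using b(3) that \<open>b = {\<beta>}\<close> by (auto simp: span_singleton)
  have "\<beta> \<noteq> 0"
    using b(2) \<open>b = {\<beta>}\<close> dependent_zero by blast
  have \<beta>: "\<beta> \<in> exact_two_forms br"
    using b(1) \<open>b = {\<beta>}\<close> by simp
  have "ce_d1 br (dual_coord \<zeta> k) \<in> exact_two_forms br" for k
    using linear_dual_coord[OF \<zeta>] by (auto simp: exact_two_forms_def)
  then have "\<exists>t. \<forall>k. ce_d1 br (dual_coord \<zeta> k) = t k *\<^sub>R \<beta>"
    using multiple by (intro choice) blast
  then obtain t where t: "ce_d1 br (dual_coord \<zeta> k) = t k *\<^sub>R \<beta>" for k
    by blast
  define w where "w = - (t 0 *\<^sub>R \<zeta> 0 + t 1 *\<^sub>R \<zeta> 1 + t 2 *\<^sub>R \<zeta> 2 + t 3 *\<^sub>R \<zeta> 3)"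
  have br_w: "br u v = \<beta> u v *\<^sub>R w" for u v
  proof -
    have "- dual_coord \<zeta> k (br u v) = t k * \<beta> u v" for k
      using fun_cong[OF fun_cong[OF t[of k]], of u v] by (simp add: ce_d1_def scaleR_fun_def)
    then have "dual_coord \<zeta> k (br u v) = - (\<beta> u v * t k)" for k
      by (metis minus_minus mult.commute)
    then show ?thesis
      using basis_expansion[OF \<zeta>, of "br u v"]
      by (simp add: w_def scaleR_add_right scaleR_diff_right)
  qed
  have "w \<noteq> 0"
  proof
    assume "w = 0"
    obtain \<phi> where \<phi>: "linear \<phi>" "\<beta> = ce_d1 br \<phi>"
      using \<beta> by (auto simp: exact_two_forms_def)
    then have "\<beta> = 0"
      using br_w \<open>w = 0\<close> linear_0[OF \<phi>(1)] by (auto simp: ce_d1_def fun_eq_iff)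
    with \<open>\<beta> \<noteq> 0\<close> show False ..
  qed
  have "\<beta> (J u) (J v) = \<beta> u v" for u v
  proof (rule ccontr)
    assume "\<beta> (J u) (J v) \<noteq> \<beta> u v"
    \<comment> \<open>\<open>r\<close> and \<open>s\<close> are the coefficients of \<open>w\<close> and \<open>J w\<close> in the integrability condition; applying
      \<open>J\<close> to the relation \<open>r w + s J w = 0\<close> gives a second one, and the two force \<open>r\<^sup>2 + s\<^sup>2 = 0\<close>.\<close>
    define r s where "r = \<beta> u v - \<beta> (J u) (J v)" and "s = \<beta> (J u) v + \<beta> u (J v)"
    have "r \<noteq> 0"
      using \<open>\<beta> (J u) (J v) \<noteq> \<beta> u v\<close> by (simp add: r_def)
    have rs: "r *\<^sub>R w + s *\<^sub>R J w = 0"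
      using int[unfolded integrable_acs_def, rule_format, of u v]
      by (simp add: br_w linear_scale[OF linJ] r_def s_def algebra_simps)
    have "J (r *\<^sub>R w + s *\<^sub>R J w) = r *\<^sub>R J w - s *\<^sub>R w"
      by (simp add: linear_add[OF linJ] linear_scale[OF linJ] almost_complex_square[OF J])
    then have Jrs: "r *\<^sub>R J w - s *\<^sub>R w = 0"
      using rs linear_0[OF linJ] by simp
    have "(r * r + s * s) *\<^sub>R w = r *\<^sub>R (r *\<^sub>R w + s *\<^sub>R J w) - s *\<^sub>R (r *\<^sub>R J w - s *\<^sub>R w)"
      by (simp add: algebra_simps)
    then have "r * r + s * s = 0"
      using rs Jrs \<open>w \<noteq> 0\<close> by simp
    then show False
      using \<open>r \<noteq> 0\<close> by (simp add: sum_squares_eq_zero_iff)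
  qed
  moreover have "\<beta> \<in> two_forms"
    using \<beta> exact_subset_closed[OF br] closed_subset_two_forms by blast
  ultimately have "\<beta> \<in> Lambda_plus J"
    by (simp add: Lambda_plus_def)
  then show ?thesis
    using multiple subspace_scale[OF subspace_Lambda_plus] by fastforce
qed

section \<open>The three values of b-plus\<close>

theorem corollary3p8:
  fixes br :: "'a::real_vector \<Rightarrow> 'a \<Rightarrow> 'a" and \<zeta> :: "nat \<Rightarrow> 'a"
  assumes "dim (UNIV :: 'a set) = 4"
    and "lie_algebra br"
    and "unimodular br"
    and "four_vector_basis \<zeta>"
  shows "(b_plus br \<zeta> = 3 \<longrightarrow>
            (\<forall>J. almost_complex J \<longrightarrow>
               tamed br J \<and> integrable_acs br J \<and> h_minus br J = 2)) \<and>
         (b_plus br \<zeta> = 2 \<longrightarrow>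
            (\<forall>J. almost_complex J \<longrightarrow>
               (tamed br J \<longleftrightarrow> \<not> integrable_acs br J) \<and>
               (tamed br J \<longleftrightarrow> h_minus br J = 1) \<and>
               (integrable_acs br J \<longleftrightarrow> Lambda_minus J \<subseteq> closed_two_forms br))) \<and>
         (b_plus br \<zeta> = 1 \<longrightarrow>
            (\<forall>J. almost_complex J \<longrightarrow>
               (tamed br J \<longleftrightarrow> \<not> (Lambda_minus J \<inter> closed_two_forms br \<noteq> {0}))))"
proof -
  note br = assms(2) and uni = assms(3) and \<zeta> = assms(4)
  let ?B = "exact_two_forms br" and ?Z = "closed_two_forms br"
  have B2: "?B \<subseteq> two_forms"
    using exact_subset_closed[OF br] closed_subset_two_forms by blast
  have dim_B: "b_plus br \<zeta> + dim ?B = 3"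
    by (rule b_plus_add_dim_exact[OF \<zeta> br uni])
  \<comment> \<open>For every \<open>J\<close>, each property in the theorem depends only on \<open>dim B\<close> and \<open>r J\<close>.\<close>
  define r z where "r J = dim (?B \<inter> Lambda_plus J)" and "z J = dim (?Z \<inter> Lambda_minus J)" for J
  have r_le: "r J \<le> dim ?B" and r_eq: "r J = dim ?B \<longleftrightarrow> ?B \<subseteq> Lambda_plus J"
    and z: "z J + dim ?B = 2 + r J" and h: "h_minus br J = z J"
    and tamed: "tamed br J \<longleftrightarrow> r J = 0"
    and z_0: "z J = 0 \<longleftrightarrow> ?Z \<inter> Lambda_minus J = {0}"
    and z_2: "z J = 2 \<longleftrightarrow> Lambda_minus J \<subseteq> ?Z"
    if J: "almost_complex J" for J
  proof -
    obtain e where e: "four_vector_basis e" "J (e 0) = e 1" "J (e 2) = e 3"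
      using adapted_basis_exists[OF \<zeta> J] by blast
    note sub = subspace_inter[OF subspace_exact subspace_Lambda_plus, of br J]
      subspace_inter[OF subspace_closed subspace_Lambda_minus, of br J]
    have subset: "?B \<inter> Lambda_plus J \<subseteq> two_forms" "?Z \<inter> Lambda_minus J \<subseteq> two_forms"
      using B2 Lambda_minus_subset[of J] by auto
    show "r J \<le> dim ?B"
      using two_forms_dim_mono(1)[OF \<zeta> sub(1) subspace_exact _ B2] by (simp add: r_def)
    have "r J = dim ?B \<longrightarrow> ?B \<inter> Lambda_plus J = ?B"
      using two_forms_dim_mono(2)[OF \<zeta> sub(1) subspace_exact _ B2] by (simp add: r_def)
    then show "r J = dim ?B \<longleftrightarrow> ?B \<subseteq> Lambda_plus J"
      by (auto simp: r_def Int_absorb2)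
    show "z J + dim ?B = 2 + r J"
      unfolding z_def r_def by (rule dim_closed_anti_invariant[OF e J br uni])
    show "h_minus br J = z J"
      unfolding z_def by (rule h_minus_eq_dim[OF e J br uni])
    show "tamed br J \<longleftrightarrow> r J = 0"
      using tamed_iff_no_invariant_exact_form[OF e J br uni] dim_eq_0_iff_trivial[OF \<zeta> sub(1) subset(1)]
      by (simp add: r_def)
    show "z J = 0 \<longleftrightarrow> ?Z \<inter> Lambda_minus J = {0}"
      using dim_eq_0_iff_trivial[OF \<zeta> sub(2) subset(2)] by (simp add: z_def)
    have "dim (Lambda_minus J) = 2"
      using dim_Lambda_minus[OF e J] dim_form_coords_image[OF e(1) subspace_Lambda_minus Lambda_minus_subset]
      by simp
    moreover have "z J = dim (Lambda_minus J) \<longrightarrow> ?Z \<inter> Lambda_minus J = Lambda_minus J"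
      using two_forms_dim_mono(2)[OF \<zeta> sub(2) subspace_Lambda_minus _ Lambda_minus_subset]
      by (simp add: z_def)
    ultimately show "z J = 2 \<longleftrightarrow> Lambda_minus J \<subseteq> ?Z"
      by (auto simp: z_def Int_absorb1)
  qed
  show ?thesis
  proof (intro conjI impI allI)
    fix J :: "'a \<Rightarrow> 'a" assume b: "b_plus br \<zeta> = 3" and J: "almost_complex J"
    then have "dim ?B = 0" "r J = 0"
      using dim_B r_le[OF J] by simp_all
    then show "tamed br J" "integrable_acs br J" "h_minus br J = 2"
      using tamed[OF J] integrable_if_exact_invariant[OF \<zeta> J br] r_eq[OF J] h[OF J] z[OF J] by simp_all
  next
    fix J :: "'a \<Rightarrow> 'a" assume b: "b_plus br \<zeta> = 2" and J: "almost_complex J"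
    then have "dim ?B = 1"
      using dim_B by simp
    then have int: "integrable_acs br J \<longleftrightarrow> r J = 1"
      using integrable_if_exact_invariant[OF \<zeta> J br] exact_invariant_if_integrable[OF \<zeta> J br] r_eq[OF J]
      by auto
    have "r J = 0 \<or> r J = 1" "z J = 1 + r J"
      using \<open>dim ?B = 1\<close> r_le[OF J] z[OF J] by auto
    then show "tamed br J \<longleftrightarrow> \<not> integrable_acs br J" "tamed br J \<longleftrightarrow> h_minus br J = 1"
      "integrable_acs br J \<longleftrightarrow> Lambda_minus J \<subseteq> ?Z"
      using int tamed[OF J] h[OF J] z_2[OF J] by auto
  next
    fix J :: "'a \<Rightarrow> 'a" assume b: "b_plus br \<zeta> = 1" and J: "almost_complex J"
    then have "z J = r J"
      using dim_B z[OF J] by simp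
    then show "tamed br J \<longleftrightarrow> \<not> (Lambda_minus J \<inter> ?Z \<noteq> {0})"
      using tamed[OF J] z_0[OF J] by (simp add: Int_commute)
  qed
qed

end
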